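(* Consider the unconstrained discounted stochastic game described in the context, and assume the following. (A1) The functions $c_i^\ell(x,\cdot)$ are continuous on $A$ for all $x\in X$, $i\in\mathcal N$ and $\ell\in\mathcal L_0$. (A2) The transition probability has the form $p(B|x,\pmb a)=\int_B\delta(x,y,\pmb a)\,\mu(dy)$ for $B\in\mathcal F$, where $\mu$ is a probability measure on $\mathcal F$ and $\delta$ is a product measurable non-negative function such that, if $\pmb a^n\to\pmb a$ as $n\to\infty$, then $\int_X|\delta(x,y,\pmb a^n)-\delta(x,y,\pmb a)|\,\mu(dy)\to0$ (for each $x\in X$). Then, for any $\varepsilon>0$, the unconstrained discounted stochastic game has a stationary $\varepsilon$-equilibrium, that is, there is $\pmb\pi^*\in\Phi$ such that $$J_i^0(\pmb\pi^* )(x)-\varepsilon\le\inf_{\sigma_i\in\Pi_i}J_i^0([\pmb\pi^*_{-i},\sigma_i])(x)$$ for every player $i\in\mathcal N$ and all initial states $x\in X$.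
   Context: Stochastic game. $\mathcal N=\{1,\dots,N\}$ is the set of players. $X$ is a state space endowed with a countably generated $\sigma$-algebra $\mathcal F$. $A_i$ is a compact metric action space of player $i$ with its Borel $\sigma$-algebra; $A=\prod_{j\in\mathcal N}A_j$, $\mathbb K=\{(x,\pmb a):x\in X,\ \pmb a=(a_1,\dots,a_N)\in A\}$. Let $\mathcal L_0=\{0,1,\dots,L\}$. The functions $c_i^\ell:\mathbb K\to\mathbb R$ ($i\in\mathcal N$, $\ell\in\mathcal L_0$) are product measurable, and there is $b>0$ with $|c_i^\ell(x,\pmb a)|\le b$ for all $i,\ell,(x,\pmb a)$. In the unconstrained game the constraints are dropped and only the cost-per-stage functions $c_i^0$ enter. $p(dy|x,\pmb a)$ is the transition probability on $X$ and $\alpha\in(0,1)$ is the discount factor. Strategies. $H^1=X$, and $H^t$ is the set of histories $h^t=(x^1,\pmb a^1,\dots,x^t)$ up to stage $t$, with $(x^k,\pmb a^k)\in\mathbb K$ for $k<t$. A strategy of player $i$ is a sequence $\pi_i=(\pi_i^t)_{t\in\mathbb N}$, each $\pi_i^t$ being a transition probability from $H^t$ to $A_i$; $\Pi_i$ is the set of all strategies of player $i$. $\Phi_i$ is the set of transition probabilities from $X$ to $A_i$; $\varphi_i\in\Phi_i$ is identified with the stationary strategy using $\varphi_i(\cdot|x^t)$ at each stage $t$. $\Pi=\prod_i\Pi_i$, $\Phi=\prod_i\Phi_i$; players randomize independently given the history. For $\pmb\pi\in\Pi$ and $x\in X$, $\mathbb E_x^{\pmb\pi}$ is the expectation with respect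 to the unique (Ionescu-Tulcea) probability measure on infinite histories induced by $\pmb\pi$, $p$ and initial state $x$. The discounted cost of player $i$ is $$J_i^0(\pmb\pi)(x)=(1-\alpha)\,\mathbb E_x^{\pmb\pi}\Big[\sum_{t=1}^\infty\alpha^{t-1}c_i^0(x^t,\pmb a^t)\Big].$$ $[\pmb\pi_{-i},\sigma_i]$ is the multi-strategy in which player $i$ uses $\sigma_i$ and every $j\ne i$ uses $\pi_j$. *)

theory Defs
  imports "HOL-Probability.Probability"
begin

text \<open>
  The players are the elements of a finite type; the action space of player \<open>i\<close> is a set
  \<open>A i\<close> inside one ambient metric space (finitely many metric spaces always embed isometrically
  into a common one). Of the measure \<open>X\<close> only the carrier set and the sigma-algebra matter; it is the state space.
\<close>

definition action_space :: "('i \<Rightarrow> 'a::metric_space set) \<Rightarrow> 'i \<Rightarrow> 'a measure" where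
  "action_space A i = restrict_space borel (A i)"

definition joint_actions :: "('i \<Rightarrow> 'a::metric_space set) \<Rightarrow> ('i \<Rightarrow> 'a) measure" where
  "joint_actions A = (\<Pi>\<^sub>M i\<in>UNIV. action_space A i)"

definition state_actions ::
  "'x measure \<Rightarrow> ('i \<Rightarrow> 'a::metric_space set) \<Rightarrow> ('x \<times> ('i \<Rightarrow> 'a)) measure" where
  "state_actions X A = X \<Otimes>\<^sub>M joint_actions A"

definition countably_generated :: "'x measure \<Rightarrow> bool" where
  "countably_generated X \<longleftrightarrow>
     (\<exists>G. countable G \<and> G \<subseteq> Pow (space X) \<and> sets X = sigma_sets (space X) G)"

text \<open>
  Stages are counted from 0. A history at stage \<open>t\<close> is a pair of the sequence of the \<open>t\<close> past
  state-action pairs and the current state.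
\<close>

type_synonym ('x, 'i, 'a) history = "(nat \<Rightarrow> 'x \<times> ('i \<Rightarrow> 'a)) \<times> 'x"
type_synonym ('x, 'i, 'a) strategy = "nat \<Rightarrow> ('x, 'i, 'a) history \<Rightarrow> 'a measure"

definition histories ::
  "'x measure \<Rightarrow> ('i \<Rightarrow> 'a::metric_space set) \<Rightarrow> nat \<Rightarrow> ('x, 'i, 'a) history measure" where
  "histories X A t = (\<Pi>\<^sub>M k\<in>{0..<t}. state_actions X A) \<Otimes>\<^sub>M X"

definition strategies ::
  "'x measure \<Rightarrow> ('i \<Rightarrow> 'a::metric_space set) \<Rightarrow> 'i \<Rightarrow> ('x, 'i, 'a) strategy set" where
  "strategies X A i = {\<pi>. \<forall>t. \<pi> t \<in> histories X A t \<rightarrow>\<^sub>M prob_algebra (action_space A i)}"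

definition stationary_strategies ::
  "'x measure \<Rightarrow> ('i \<Rightarrow> 'a::metric_space set) \<Rightarrow> 'i \<Rightarrow> ('x \<Rightarrow> 'a measure) set" where
  "stationary_strategies X A i = X \<rightarrow>\<^sub>M prob_algebra (action_space A i)"

definition stationary :: "('x \<Rightarrow> 'a measure) \<Rightarrow> ('x, 'i, 'a) strategy" where
  "stationary \<phi> = (\<lambda>t (\<omega>, x). \<phi> x)"

text \<open>
  Conditional law of the state-action pair at stage \<open>t\<close>, given the pairs \<open>\<omega>\<close> of the earlier
  stages: the state is the initial state \<open>x\<close> if \<open>t = 0\<close> and is drawn by the transition
  probability otherwise; then the players draw their actions independently.
\<close>

definition stage_kernel ::
  "'x measure \<Rightarrow> ('i \<Rightarrow> 'a::metric_space set) \<Rightarrow> ('x \<times> ('i \<Rightarrow> 'a) \<Rightarrow> 'x measure) \<Rightarrow>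
   ('i \<Rightarrow> ('x, 'i, 'a) strategy) \<Rightarrow> 'x \<Rightarrow>
   nat \<Rightarrow> (nat \<Rightarrow> 'x \<times> ('i \<Rightarrow> 'a)) \<Rightarrow> ('x \<times> ('i \<Rightarrow> 'a)) measure" where
  "stage_kernel X A p \<pi> x t \<omega> =
     bind (if t = 0 then return X x else p (\<omega> (t - 1)))
       (\<lambda>y. distr (\<Pi>\<^sub>M i\<in>UNIV. \<pi> i t (\<omega>, y)) (state_actions X A) (\<lambda>a. (y, a)))"

definition play_measure ::
  "'x measure \<Rightarrow> ('i \<Rightarrow> 'a::metric_space set) \<Rightarrow> ('x \<times> ('i \<Rightarrow> 'a) \<Rightarrow> 'x measure) \<Rightarrow>
   ('i \<Rightarrow> ('x, 'i, 'a) strategy) \<Rightarrow> 'x \<Rightarrow> (nat \<Rightarrow> 'x \<times> ('i \<Rightarrow> 'a)) measure" where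
  "play_measure X A p \<pi> x =
     projective_family.lim UNIV
       (Ionescu_Tulcea.CI (stage_kernel X A p \<pi> x) (\<lambda>t. state_actions X A))
       (\<lambda>t. state_actions X A)"

definition discounted_cost ::
  "'x measure \<Rightarrow> ('i \<Rightarrow> 'a::metric_space set) \<Rightarrow> ('x \<times> ('i \<Rightarrow> 'a) \<Rightarrow> 'x measure) \<Rightarrow> real \<Rightarrow>
   ('x \<times> ('i \<Rightarrow> 'a) \<Rightarrow> real) \<Rightarrow> ('i \<Rightarrow> ('x, 'i, 'a) strategy) \<Rightarrow> 'x \<Rightarrow> real" where
  "discounted_cost X A p \<alpha> c \<pi> x =
     (1 - \<alpha>) * (\<integral>\<omega>. (\<Sum>t. \<alpha> ^ t * c (\<omega> t)) \<partial>play_measure X A p \<pi> x)"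

end

theory Submission
  imports Defs
begin

text \<open>
  Only the values \<open>\<integral> v dp(x, a)\<close> of the continuation cost matter for play in state \<open>x\<close>. Since
  \<open>L\<^sup>1(\<mu>)\<close> is separable and \<open>a \<mapsto> (c(x, a), \<delta>(x, \<cdot>, a))\<close> is uniformly continuous on the
  compact action space, the states fall into countably many measurable types such that, up to \<open>e\<close>,
  the data depend on the type only and finitely many actions per type suffice. The game with countably many types and finitely many
  actions is solved by a fixed point on a countable power of an interval: a vector \<open>Q\<close> of
  prospective costs, one for each player, type and action, determines mixed actions that put
  weight only on nearly cheapest actions, hence stationary play, values and new prospective costs.
  At a fixed point the one-shot inequalities hold up to a multiple of \<open>e\<close> in every state, and
  iterating them along the play compares every deviation with the value.
\<close>

section \<open>Fixed points in countable powers of an interval\<close>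

text \<open>Working with the stationary strategies themselves meets an obstacle: on an uncountable
  state space, the weak topologies that make them compact do not make the cost of a product of
  several players' mixed actions continuous. With countably many types coordinatewise convergence is
  enough. The unknown is the cost vector and not the strategies, because it ranges over a box and
  nearly best replies can be chosen as a continuous function of it; so no set-valued map occurs. No
  transition law between types is built: the values of the types are read as a function
  \<open>\<lambda>y. val Q i (T y)\<close> of the original state and integrated against the original
  law at a representative state. The errors are uniform in the state: \<open>(1 + b) * e\<close> for
  passing to the representative, \<open>(1 + b) * e\<close> for replacing a deviation by a listed
  action, \<open>e\<close> for nearly cheapest actions. Their sum \<open>(3 + 2 * b) * e\<close>
  bounds the loss per stage; discounting divides it by \<open>1 - \<alpha>\<close>, and it counts
  twice, for the equilibrium play and for the deviation.\<close>

lemma tendsto_fun_iff: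
  fixes f :: "'c \<Rightarrow> 'k \<Rightarrow> 'b::topological_space"
  shows "(f \<longlongrightarrow> l) F \<longleftrightarrow> (\<forall>i. ((\<lambda>c. f c i) \<longlongrightarrow> l i) F)"
  using limitin_componentwise[of "\<lambda>_. euclidean" UNIV f l F]
  by (simp add: euclidean_product_topology)

text \<open>Tychonoff's theorem gives compactness. A countable index type makes the product first
  countable, and this turns compactness into convergent subsequences.\<close>

lemma seq_compact_Pi_UNIV:
  fixes S :: "'k::countable \<Rightarrow> 'b::metric_space set"
  assumes "\<And>k. compact (S k)"
  shows "seq_compact (PiE UNIV S)"
proof -
  have "compactin (product_topology (\<lambda>_. euclidean) UNIV) (PiE UNIV S)"
    using assms by (auto simp: compactin_PiE)
  then have "compact (PiE UNIV S)"
    by (simp add: euclidean_product_topology)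
  then show ?thesis
    by (rule compact_imp_seq_compact)
qed

text \<open>Kuhn's combinatorial lemma on grids of mesh \<open>1/p\<close> in dimension \<open>p\<close> yields, for each
  coordinate, two nearby grid points moved in opposite directions; pass to the limit.\<close>

lemma unit_cube_fixed_point:
  fixes f :: "(nat \<Rightarrow> real) \<Rightarrow> nat \<Rightarrow> real"
  assumes maps: "\<And>x n. (\<And>k. x k \<in> {0..1}) \<Longrightarrow> f x n \<in> {0..1}"
    and cont: "\<And>X x n. (\<And>m k. X m k \<in> {0..1}) \<Longrightarrow> (\<And>k. (\<lambda>m. X m k) \<longlonglongrightarrow> x k) \<Longrightarrow>
      (\<lambda>m. f (X m) n) \<longlonglongrightarrow> f x n"
  shows "\<exists>x. (\<forall>k. x k \<in> {0..1}) \<and> f x = x"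
proof -
  \<comment> \<open>Padding with 0 from coordinate \<open>p\<close> on places the grids of all
    dimensions in one cube, where their points can converge. The \<open>min\<close> keeps the point
    in the cube for every \<open>q\<close>, so \<open>maps\<close> applies to it without a side
    condition.\<close>
  define pt :: "nat \<Rightarrow> (nat \<Rightarrow> nat) \<Rightarrow> nat \<Rightarrow> real" where
    "pt p q = (\<lambda>k. if k < p then real (min (q k) p) / real p else 0)" for p q
  have pt: "pt p q k \<in> {0..1}" for p q k
    by (auto simp: pt_def divide_le_eq_1)
  have "\<exists>q. (\<forall>i<p. q i < p) \<and> (\<forall>i<p. \<exists>r s. (\<forall>j<p. q j \<le> r j \<and> r j \<le> q j + 1) \<and>
      (\<forall>j<p. q j \<le> s j \<and> s j \<le> q j + 1) \<and> f (pt p r) i \<ge> pt p r i \<and> f (pt p s) i \<le> pt p s i)"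
    if "p > 0" for p
  proof -
    \<comment> \<open>Label 0 certifies that \<open>f\<close> does not lower coordinate
      \<open>i\<close>, label 1 that it does not raise it. On the two faces Kuhn's lemma prescribes
      the label; the certificate holds there because \<open>f\<close> stays in the cube.\<close>
    define label :: "(nat \<Rightarrow> nat) \<Rightarrow> nat \<Rightarrow> nat" where
      "label x i = (if x i = 0 \<or> x i < p \<and> f (pt p x) i \<ge> pt p x i then 0 else 1)" for x i
    have l0: "f (pt p x) i \<ge> pt p x i" if "label x i = 0" "i < p" "x i \<le> p" for x i
      using that maps[where n=i, OF pt[of p x]] by (auto simp: label_def pt_def split: if_splits)
    have l1: "f (pt p x) i \<le> pt p x i" if "label x i \<noteq> 0" "i < p" "x i \<le> p" for x i
    proof (cases "x i = p")
      case True
      then show ?thesis using that maps[where n=i, OF pt[of p x]] by (auto simp: pt_def)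
    next
      case False
      then show ?thesis using that by (auto simp: label_def split: if_splits)
    qed
    have "\<forall>x. (\<forall>i<p. x i \<le> p) \<longrightarrow> (\<forall>i<p. label x i = 0 \<or> label x i = 1)"
        "\<forall>x. (\<forall>i<p. x i \<le> p) \<longrightarrow> (\<forall>i<p. x i = 0 \<longrightarrow> label x i = 0)"
        "\<forall>x. (\<forall>i<p. x i \<le> p) \<longrightarrow> (\<forall>i<p. x i = p \<longrightarrow> label x i = 1)"
      using that by (auto simp: label_def)
    from kuhn_lemma[OF that this] obtain q where q: "\<forall>i<p. q i < p"
      and sep: "\<forall>i<p. \<exists>r s. (\<forall>j<p. q j \<le> r j \<and> r j \<le> q j + 1) \<and>
        (\<forall>j<p. q j \<le> s j \<and> s j \<le> q j + 1) \<and> label r i \<noteq> label s i"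
      by blast
    show ?thesis
    proof (rule exI[of _ q], intro conjI allI impI)
      fix i assume i: "i < p"
      obtain r s where r: "\<forall>j<p. q j \<le> r j \<and> r j \<le> q j + 1"
        and s: "\<forall>j<p. q j \<le> s j \<and> s j \<le> q j + 1" and ne: "label r i \<noteq> label s i"
        using sep i by blast
      have le: "r i \<le> p" "s i \<le> p" using r s q i
        by (metis Suc_eq_plus1 Suc_leI le_trans)+
      show "\<exists>r s. (\<forall>j<p. q j \<le> r j \<and> r j \<le> q j + 1) \<and> (\<forall>j<p. q j \<le> s j \<and> s j \<le> q j + 1) \<and>
          f (pt p r) i \<ge> pt p r i \<and> f (pt p s) i \<le> pt p s i"
      proof (cases "label r i = 0")
        case True
        with ne have "label s i \<noteq> 0" by auto
        then show ?thesis using l0[of r i] l1[of s i] r s i le True by blast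
      next
        case False
        with ne have "label s i = 0" by (auto simp: label_def split: if_splits)
        then show ?thesis using l0[of s i] l1[of r i] r s i le False by blast
      qed
    qed (use q in auto)
  qed
  then have "\<exists>q. \<forall>p>0. (\<forall>i<p. q p i < p) \<and> (\<forall>i<p. \<exists>r s. (\<forall>j<p. q p j \<le> r j \<and> r j \<le> q p j + 1) \<and>
      (\<forall>j<p. q p j \<le> s j \<and> s j \<le> q p j + 1) \<and> f (pt p r) i \<ge> pt p r i \<and> f (pt p s) i \<le> pt p s i)"
    by metis
  then obtain q where q: "\<And>p i. i < p \<Longrightarrow> q p i < p"
    and ex: "\<And>p i. i < p \<Longrightarrow> \<exists>r s. (\<forall>j<p. q p j \<le> r j \<and> r j \<le> q p j + 1) \<and>
      (\<forall>j<p. q p j \<le> s j \<and> s j \<le> q p j + 1) \<and> f (pt p r) i \<ge> pt p r i \<and> f (pt p s) i \<le> pt p s i"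
    by (metis gr_zeroI less_nat_zero_code)
  obtain x \<rho> where x: "x \<in> PiE UNIV (\<lambda>_::nat. {0..1::real})" and \<rho>: "strict_mono \<rho>"
    and lim: "((\<lambda>p. pt p (q p)) \<circ> \<rho>) \<longlonglongrightarrow> x"
    by (rule seq_compactE[OF seq_compact_Pi_UNIV[of "\<lambda>_. {0..1}"], of "\<lambda>p. pt p (q p)"])
      (use pt in auto)
  have limk: "(\<lambda>m. pt (\<rho> m) (q (\<rho> m)) k) \<longlonglongrightarrow> x k" for k
    using lim by (simp add: tendsto_fun_iff o_def)
  \<comment> \<open>The corners of a grid cell differ by at most \<open>1/p\<close> in each
    coordinate and merge in the limit. Corners belonging to coordinate \<open>i\<close> exist only
    in dimensions above \<open>i\<close>, hence the premise \<open>i < p\<close>; this concerns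
    finitely many terms.\<close>
  have near: "(\<lambda>m. pt (\<rho> m) (r (\<rho> m)) k) \<longlonglongrightarrow> x k"
    if r: "\<And>p j. j < p \<Longrightarrow> i < p \<Longrightarrow> q p j \<le> r p j \<and> r p j \<le> q p j + 1" for r i k
  proof -
    have "(\<lambda>m. pt (\<rho> m) (r (\<rho> m)) k - pt (\<rho> m) (q (\<rho> m)) k) \<longlonglongrightarrow> 0"
    proof (rule Lim_null_comparison)
      show "(\<lambda>m. 1 / real (\<rho> m)) \<longlonglongrightarrow> 0"
        using LIMSEQ_subseq_LIMSEQ[OF lim_inverse_n \<rho>] by (simp add: o_def inverse_eq_divide)
      show "\<forall>\<^sub>F m in sequentially. norm (pt (\<rho> m) (r (\<rho> m)) k - pt (\<rho> m) (q (\<rho> m)) k) \<le> 1 / real (\<rho> m)"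
      proof (rule eventually_sequentiallyI[of "Suc (i + k)"])
        fix m assume "Suc (i + k) \<le> m"
        then have m: "i < \<rho> m" "k < \<rho> m" using seq_suble[OF \<rho>, of m] by auto
        have "\<bar>real (min (r (\<rho> m) k) (\<rho> m)) - real (min (q (\<rho> m) k) (\<rho> m))\<bar> \<le> 1"
          using r[OF m(2) m(1)] by (auto simp: min_def)
        then show "norm (pt (\<rho> m) (r (\<rho> m)) k - pt (\<rho> m) (q (\<rho> m)) k) \<le> 1 / real (\<rho> m)"
          using m by (simp add: pt_def divide_simps flip: diff_divide_distrib)
      qed
    qed
    from tendsto_add[OF this limk[of k]] show ?thesis by simp
  qed
  have "f x i = x i" for i
  proof -
    have "\<forall>p. \<exists>r s. i < p \<longrightarrow> (\<forall>j<p. q p j \<le> r j \<and> r j \<le> q p j + 1) \<and>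
      (\<forall>j<p. q p j \<le> s j \<and> s j \<le> q p j + 1) \<and> f (pt p r) i \<ge> pt p r i \<and> f (pt p s) i \<le> pt p s i"
      using ex[of i] by blast
    then obtain r s where rs: "\<And>p. i < p \<Longrightarrow> (\<forall>j<p. q p j \<le> r p j \<and> r p j \<le> q p j + 1) \<and>
      (\<forall>j<p. q p j \<le> s p j \<and> s p j \<le> q p j + 1) \<and>
      f (pt p (r p)) i \<ge> pt p (r p) i \<and> f (pt p (s p)) i \<le> pt p (s p) i"
      by metis
    have r: "(\<lambda>m. pt (\<rho> m) (r (\<rho> m)) k) \<longlonglongrightarrow> x k" and s: "(\<lambda>m. pt (\<rho> m) (s (\<rho> m)) k) \<longlonglongrightarrow> x k" for k
      by (rule near[of i]; use rs in blast)+
    have ev: "\<forall>\<^sub>F m in sequentially. i < \<rho> m"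
      by (rule eventually_sequentiallyI[of "Suc i"]) (use seq_suble[OF \<rho>] in \<open>meson Suc_le_lessD order_trans\<close>)
    show ?thesis
    proof (rule antisym)
      show "f x i \<le> x i"
        by (rule tendsto_le[OF _ s[of i] cont[of "\<lambda>m. pt (\<rho> m) (s (\<rho> m))" x i]])
          (use pt s ev rs in \<open>auto elim!: eventually_mono\<close>)
      show "x i \<le> f x i"
        by (rule tendsto_le[OF _ cont[of "\<lambda>m. pt (\<rho> m) (r (\<rho> m))" x i] r[of i]])
          (use pt r ev rs in \<open>auto elim!: eventually_mono\<close>)
    qed
  qed
  then show ?thesis using x by (auto intro!: exI[of _ x])
qed

text \<open>An affine change of scale and the coding \<open>to_nat\<close> of the indices reduce
  this to the unit cube. Only the coordinates \<open>to_nat k\<close> of the fixed point are read by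
  \<open>emb\<close>, and there \<open>from_nat\<close> inverts the coding.\<close>

lemma countable_box_fixed_point:
  fixes f :: "('k::countable \<Rightarrow> real) \<Rightarrow> 'k \<Rightarrow> real"
  assumes "l < u"
    and maps: "\<And>x k. (\<And>k. x k \<in> {l..u}) \<Longrightarrow> f x k \<in> {l..u}"
    and cont: "\<And>X x k. (\<And>m k. X m k \<in> {l..u}) \<Longrightarrow> (\<And>k. (\<lambda>m. X m k) \<longlonglongrightarrow> x k) \<Longrightarrow>
      (\<lambda>m. f (X m) k) \<longlonglongrightarrow> f x k"
  obtains x where "\<And>k. x k \<in> {l..u}" "f x = x"
proof -
  define emb where "emb y = (\<lambda>k::'k. l + (u - l) * y (to_nat k))" for y :: "nat \<Rightarrow> real"
  define g where "g y n = (f (emb y) (from_nat n) - l) / (u - l)" for y n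
  have emb: "emb y k \<in> {l..u}" if "\<And>n. y n \<in> {0..1}" for y k
  proof -
    have "(u - l) * y (to_nat k) \<le> (u - l) * 1" "0 \<le> (u - l) * y (to_nat k)"
      using that[of "to_nat k"] \<open>l < u\<close> by (intro mult_left_mono mult_nonneg_nonneg; auto)+
    then show ?thesis by (simp add: emb_def)
  qed
  have "\<exists>y. (\<forall>n. y n \<in> {0..1}) \<and> g y = y"
  proof (rule unit_cube_fixed_point)
    fix y :: "nat \<Rightarrow> real" and n assume "\<And>k. y k \<in> {0..1}"
    from maps[where k="from_nat n", OF emb[of y, OF this]] show "g y n \<in> {0..1}"
      using \<open>l < u\<close> by (auto simp: g_def divide_le_eq_1)
  next
    fix Y :: "nat \<Rightarrow> nat \<Rightarrow> real" and y n
    assume Y: "\<And>m k. Y m k \<in> {0..1}" "\<And>k. (\<lambda>m. Y m k) \<longlonglongrightarrow> y k"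
    have "(\<lambda>m. f (emb (Y m)) (from_nat n)) \<longlonglongrightarrow> f (emb y) (from_nat n)"
      by (rule cont[OF emb[OF Y(1)]]) (auto simp: emb_def intro!: tendsto_intros Y(2))
    then show "(\<lambda>m. g (Y m) n) \<longlonglongrightarrow> g y n"
      unfolding g_def using \<open>l < u\<close> by (auto intro!: tendsto_intros)
  qed
  then obtain y where y: "\<And>n. y n \<in> {0..1}" and fp: "g y = y" by auto
  have "f (emb y) k = emb y k" for k
    using fun_cong[OF fp, of "to_nat k"] \<open>l < u\<close> by (simp add: g_def emb_def field_simps)
  with emb[OF y] show ?thesis by (intro that[of "emb y"]) auto
qed

section \<open>Stage expectations and the one-step inequality\<close>

lemma abs_integral_le_const:
  fixes f :: "'b \<Rightarrow> real"
  assumes "prob_space M" "f \<in> borel_measurable M" "\<And>x. x \<in> space M \<Longrightarrow> \<bar>f x\<bar> \<le> B"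
  shows "\<bar>\<integral>x. f x \<partial>M\<bar> \<le> B"
proof -
  interpret prob_space M by fact
  have "integrable M f"
    using assms by (intro integrable_const_bound[of _ B]) auto
  then show ?thesis
    using integral_ge_const[of f "- B"] integral_le_const[of f B] assms(3)
    by (fastforce simp: abs_le_iff minus_le_iff)
qed

lemma integral_bind_prob:
  fixes f :: "'b \<Rightarrow> real"
  assumes "f \<in> borel_measurable K" "\<And>x. x \<in> space K \<Longrightarrow> \<bar>f x\<bar> \<le> B"
    and "N \<in> M \<rightarrow>\<^sub>M prob_algebra K" "prob_space M"
  shows "(\<integral>x. f x \<partial>bind M N) = (\<integral>x. \<integral>y. f y \<partial>N x \<partial>M)"
proof (rule integral_bind[where K = K and B = B and B' = 1])
  have "emeasure (N x) (space (N x)) \<le> ennreal 1" if "x \<in> space M" for x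
    using measurable_space[OF assms(3) that]
    by (auto simp: space_prob_algebra prob_space.emeasure_space_1)
  then show "AE x in M. emeasure (N x) (space (N x)) \<le> ennreal 1" by auto
qed (use assms in \<open>auto intro: measurable_prob_algebraD prob_space.finite_measure\<close>)

lemma measurable_integral_kernel:
  fixes f :: "'b \<Rightarrow> real"
  assumes "N \<in> M \<rightarrow>\<^sub>M prob_algebra K" "f \<in> borel_measurable K"
  shows "(\<lambda>x. \<integral>y. f y \<partial>N x) \<in> borel_measurable M"
  using measurable_compose[OF measurable_prob_algebraD[OF assms(1)] integral_measurable_subprob_algebra[OF assms(2)]] .

lemma kernelD:
  assumes "N \<in> M \<rightarrow>\<^sub>M prob_algebra K" "x \<in> space M"
  shows "prob_space (N x)" "sets (N x) = sets K" "space (N x) = space K"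
  using measurable_space[OF assms] by (auto simp: space_prob_algebra dest: sets_eq_imp_space_eq)

text \<open>Rectangles form an intersection-stable generator, and on a rectangle the product measure
  is a finite product of measurable functions. In this way independent randomization depends
  measurably on the history.\<close>

lemma measurable_PiM_kernel:
  assumes "finite I" and K: "\<And>i. i \<in> I \<Longrightarrow> K i \<in> M \<rightarrow>\<^sub>M prob_algebra (N i)"
  shows "(\<lambda>x. PiM I (\<lambda>i. K i x)) \<in> M \<rightarrow>\<^sub>M prob_algebra (PiM I N)"
proof (rule measurable_prob_algebra_generated[OF sets_PiM Int_stable_prod_algebra prod_algebra_sets_into_space])
  fix x assume x: "x \<in> space M"
  show "prob_space (PiM I (\<lambda>i. K i x))"
    by (intro prob_space_PiM kernelD[OF K x])
  show "sets (PiM I (\<lambda>i. K i x)) = sets (PiM I N)"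
    by (intro sets_PiM_cong kernelD[OF K x] refl)
next
  fix E assume "E \<in> prod_algebra I N"
  then obtain F where F: "E = Pi\<^sub>E I F" "\<And>i. i \<in> I \<Longrightarrow> F i \<in> sets (N i)"
    by (auto simp: prod_algebra_eq_finite[OF \<open>finite I\<close>] Pi_iff)
  have "(\<lambda>x. \<Prod>i\<in>I. emeasure (K i x) (F i)) \<in> borel_measurable M"
  proof (rule borel_measurable_prod_ennreal)
    fix i assume "i \<in> I"
    show "(\<lambda>x. emeasure (K i x) (F i)) \<in> borel_measurable M"
      using measurable_compose[OF measurable_prob_algebraD[OF K[OF \<open>i \<in> I\<close>]]
          measurable_emeasure_subprob_algebra[OF F(2)[OF \<open>i \<in> I\<close>]]] .
  qed
  moreover have "emeasure (PiM I (\<lambda>i. K i x)) E = (\<Prod>i\<in>I. emeasure (K i x) (F i))" if x: "x \<in> space M" for x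
  proof -
    have "emeasure (PiM I (\<lambda>i. K i x)) (prod_emb I (\<lambda>i. K i x) I (Pi\<^sub>E I F)) = (\<Prod>i\<in>I. emeasure (K i x) (F i))"
      using F kernelD[OF K x] \<open>finite I\<close> by (intro emeasure_PiM_emb) auto
    moreover have "prod_emb I (\<lambda>i. K i x) I (Pi\<^sub>E I F) = Pi\<^sub>E I F"
      by (rule prod_emb_PiE_same_index) (use F(2) kernelD(3)[OF K x] in \<open>auto dest: sets.sets_into_space\<close>)
    ultimately show ?thesis using F(1) by simp
  qed
  ultimately show "(\<lambda>x. emeasure (PiM I (\<lambda>i. K i x)) E) \<in> borel_measurable M"
    by (simp cong: measurable_cong)
qed

section \<open>Law of the play under a fixed profile and initial state\<close>

locale controlled_process =
  fixes X :: "'x measure" and A :: "'i::finite \<Rightarrow> 'a::metric_space set"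
    and p :: "'x \<times> ('i \<Rightarrow> 'a) \<Rightarrow> 'x measure"
    and \<pi> :: "'i \<Rightarrow> ('x, 'i, 'a) strategy" and x\<^sub>0 :: 'x
  assumes transition: "p \<in> state_actions X A \<rightarrow>\<^sub>M prob_algebra X"
    and strategies: "\<And>i. \<pi> i \<in> strategies X A i"
    and initial: "x\<^sub>0 \<in> space X"
begin

abbreviation "S \<equiv> state_actions X A"
abbreviation "H t \<equiv> PiM {0..<t::nat} (\<lambda>_. S)"
abbreviation "\<kappa> \<equiv> stage_kernel X A p \<pi> x\<^sub>0"

definition state_law :: "nat \<Rightarrow> (nat \<Rightarrow> 'x \<times> ('i \<Rightarrow> 'a)) \<Rightarrow> 'x measure" where
  "state_law t \<omega> = (if t = 0 then return X x\<^sub>0 else p (\<omega> (t - 1)))"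

lemma measurable_state_law: "state_law t \<in> H t \<rightarrow>\<^sub>M prob_algebra X"
proof (cases "t = 0")
  case True
  have "(\<lambda>\<omega>. return X x\<^sub>0) \<in> H t \<rightarrow>\<^sub>M prob_algebra X"
    using initial by (intro measurable_const) (auto simp: space_prob_algebra prob_space_return)
  then show ?thesis using True by (simp add: state_law_def[abs_def])
next
  case False
  have "(\<lambda>\<omega>. \<omega> (t - 1)) \<in> H t \<rightarrow>\<^sub>M S"
    using False by (intro measurable_component_singleton) auto
  from measurable_compose[OF this transition] show ?thesis
    using False by (simp add: state_law_def[abs_def])
qed

lemma measurable_joint_law:
  "(\<lambda>(\<omega>, y). PiM UNIV (\<lambda>i. \<pi> i t (\<omega>, y))) \<in> H t \<Otimes>\<^sub>M X \<rightarrow>\<^sub>M prob_algebra (joint_actions A)"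
proof -
  have "(\<lambda>h. PiM UNIV (\<lambda>i. \<pi> i t h)) \<in> H t \<Otimes>\<^sub>M X \<rightarrow>\<^sub>M prob_algebra (joint_actions A)"
    unfolding joint_actions_def
    by (intro measurable_PiM_kernel) (use strategies in \<open>auto simp: strategies_def histories_def\<close>)
  then show ?thesis by (simp add: case_prod_beta')
qed

lemma measurable_choice:
  "(\<lambda>(\<omega>, y). distr (PiM UNIV (\<lambda>i. \<pi> i t (\<omega>, y))) S (\<lambda>a. (y, a))) \<in> H t \<Otimes>\<^sub>M X \<rightarrow>\<^sub>M prob_algebra S"
proof -
  have "(\<lambda>h. distr (PiM UNIV (\<lambda>i. \<pi> i t (fst h, snd h))) S (\<lambda>a. (snd h, a))) \<in> H t \<Otimes>\<^sub>M X \<rightarrow>\<^sub>M prob_algebra S"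
  proof (rule measurable_distr_prob_space2[where M = "joint_actions A"])
    show "(\<lambda>h. PiM UNIV (\<lambda>i. \<pi> i t (fst h, snd h))) \<in> H t \<Otimes>\<^sub>M X \<rightarrow>\<^sub>M prob_algebra (joint_actions A)"
      using measurable_joint_law by (simp add: case_prod_beta')
    show "(\<lambda>(h, a). (snd h, a)) \<in> (H t \<Otimes>\<^sub>M X) \<Otimes>\<^sub>M joint_actions A \<rightarrow>\<^sub>M S"
      unfolding state_actions_def by measurable
  qed
  then show ?thesis by (simp add: case_prod_beta')
qed

lemma measurable_stage_kernel: "\<kappa> t \<in> H t \<rightarrow>\<^sub>M prob_algebra S"
proof -
  have "(\<lambda>\<omega>. bind (state_law t \<omega>) (\<lambda>y. distr (PiM UNIV (\<lambda>i. \<pi> i t (\<omega>, y))) S (\<lambda>a. (y, a)))) \<in> H t \<rightarrow>\<^sub>M prob_algebra S"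
    by (rule measurable_bind_prob_space2[OF measurable_state_law measurable_choice])
  then show ?thesis by (simp add: stage_kernel_def[abs_def] state_law_def)
qed

sublocale IT: Ionescu_Tulcea \<kappa> "\<lambda>_. S"
  by (rule Ionescu_Tulcea.intro)
    (rule measurable_prob_algebraD[OF measurable_stage_kernel], rule kernelD(1)[OF measurable_stage_kernel])

lemma integral_stage_kernel:
  fixes f :: "_ \<Rightarrow> real"
  assumes \<omega>: "\<omega> \<in> space (H t)" and f: "f \<in> borel_measurable S" "\<And>z. z \<in> space S \<Longrightarrow> \<bar>f z\<bar> \<le> B"
  shows "(\<integral>z. f z \<partial>\<kappa> t \<omega>) = (\<integral>y. \<integral>a. f (y, a) \<partial>PiM UNIV (\<lambda>i. \<pi> i t (\<omega>, y)) \<partial>state_law t \<omega>)"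
proof -
  note law = kernelD[OF measurable_state_law \<omega>]
  have choice: "(\<lambda>y. distr (PiM UNIV (\<lambda>i. \<pi> i t (\<omega>, y))) S (\<lambda>a. (y, a))) \<in> X \<rightarrow>\<^sub>M prob_algebra S"
    using measurable_compose[OF measurable_Pair1'[OF \<omega>] measurable_choice] by simp
  have "(\<integral>z. f z \<partial>\<kappa> t \<omega>) = (\<integral>y. \<integral>z. f z \<partial>distr (PiM UNIV (\<lambda>i. \<pi> i t (\<omega>, y))) S (\<lambda>a. (y, a)) \<partial>state_law t \<omega>)"
    unfolding stage_kernel_def state_law_def[symmetric]
    using choice law(1) by (intro integral_bind_prob[OF f]) (simp_all add: measurable_cong_sets[OF law(2) refl])
  also have "\<dots> = (\<integral>y. \<integral>a. f (y, a) \<partial>PiM UNIV (\<lambda>i. \<pi> i t (\<omega>, y)) \<partial>state_law t \<omega>)"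
  proof (intro Bochner_Integration.integral_cong refl integral_distr f)
    fix y assume "y \<in> space (state_law t \<omega>)"
    then have y: "y \<in> space X" by (simp add: law)
    have eq: "sets (PiM UNIV (\<lambda>i. \<pi> i t (\<omega>, y))) = sets (joint_actions A)"
      using kernelD(2)[OF measurable_joint_law, of "(\<omega>, y)"] \<omega> y by (simp add: space_pair_measure)
    show "Pair y \<in> PiM UNIV (\<lambda>i. \<pi> i t (\<omega>, y)) \<rightarrow>\<^sub>M S"
      unfolding measurable_cong_sets[OF eq refl] state_actions_def by (rule measurable_Pair1'[OF y])
  qed
  finally show ?thesis .
qed

text \<open>The constant \<open>undefined\<close> function is the empty history, the only point of
  \<open>H 0\<close>. Iterating the stage kernels from it gives the law of the first
  \<open>t\<close> state-action pairs.\<close>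

abbreviation "P\<^sub>H t \<equiv> IT.C 0 t (\<lambda>_. undefined)"

lemma history_law: "prob_space (P\<^sub>H t)" "sets (P\<^sub>H t) = sets (H t)" "space (P\<^sub>H t) = space (H t)"
proof -
  have und: "(\<lambda>_. undefined) \<in> space (H 0)" by simp
  show "prob_space (P\<^sub>H t)" "sets (P\<^sub>H t) = sets (H t)" "space (P\<^sub>H t) = space (H t)"
    using IT.prob_space_C[OF und, of t] IT.sets_C[OF und, of t] IT.space_C[OF und, of t]
    unfolding add_0 .
qed

lemma measurable_history: "f \<in> H t \<rightarrow>\<^sub>M N \<Longrightarrow> f \<in> P\<^sub>H t \<rightarrow>\<^sub>M N"
  unfolding measurable_cong_sets[OF history_law(2) refl] .

text \<open>The expectation is split into the law of the past and the conditional law of the stage,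
  so that an inequality known for each single history can be integrated. That it is the expectation
  under the play measure is shown in \<open>integral_play\<close>.\<close>

definition stage_expectation :: "nat \<Rightarrow> ('x \<times> ('i \<Rightarrow> 'a) \<Rightarrow> real) \<Rightarrow> real" where
  "stage_expectation t f = (\<integral>\<omega>. \<integral>z. f z \<partial>\<kappa> t \<omega> \<partial>P\<^sub>H t)"

text \<open>The law of \<open>Suc t\<close> pairs extends the law of \<open>t\<close> pairs by one
  kernel step, whose new coordinate has law \<open>\<kappa> t \<omega>\<close>.\<close>

lemma integral_history_last:
  fixes f :: "_ \<Rightarrow> real"
  assumes f: "f \<in> borel_measurable S" "\<And>z. z \<in> space S \<Longrightarrow> \<bar>f z\<bar> \<le> B"
  shows "(\<integral>\<omega>. f (\<omega> t) \<partial>P\<^sub>H (Suc t)) = stage_expectation t f"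
proof -
  have m: "(\<lambda>\<omega>. f (\<omega> t)) \<in> borel_measurable (H (Suc t))"
    by (rule measurable_compose[OF _ f(1)]) (rule measurable_component_singleton, simp)
  have eP: "IT.eP t \<in> P\<^sub>H t \<rightarrow>\<^sub>M prob_algebra (H (Suc t))"
    by (rule measurable_history, rule measurable_prob_algebraI[OF IT.prob_space_eP IT.measurable_eP])
  have "(\<integral>\<omega>. f (\<omega> t) \<partial>P\<^sub>H (Suc t)) = (\<integral>\<omega>. \<integral>\<omega>'. f (\<omega>' t) \<partial>IT.eP t \<omega> \<partial>P\<^sub>H t)"
    unfolding IT.C.simps add_0
    by (rule integral_bind_prob[OF m _ eP history_law(1)]) (rule f(2), auto simp: space_PiM)
  also have "\<dots> = stage_expectation t f"
    unfolding stage_expectation_def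
  proof (intro Bochner_Integration.integral_cong refl)
    fix \<omega> assume "\<omega> \<in> space (P\<^sub>H t)"
    then have \<omega>: "\<omega> \<in> space (H t)" by (simp add: history_law)
    have "fun_upd \<omega> t \<in> S \<rightarrow>\<^sub>M H (Suc t)"
      by (rule measurable_fun_upd[where J = "{0..<t}"]) (use \<omega> in auto)
    then have "fun_upd \<omega> t \<in> \<kappa> t \<omega> \<rightarrow>\<^sub>M H (Suc t)"
      unfolding measurable_cong_sets[OF kernelD(2)[OF measurable_stage_kernel \<omega>] refl] .
    then show "(\<integral>\<omega>'. f (\<omega>' t) \<partial>IT.eP t \<omega>) = (\<integral>z. f z \<partial>\<kappa> t \<omega>)"
      unfolding IT.eP_def by (subst integral_distr[OF _ m]) simp_all
  qed
  finally show ?thesis .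
qed

section \<open>The measure on infinite plays and the discounted cost as a series\<close>

lemma play_measure: "play_measure X A p \<pi> x\<^sub>0 = IT.PF.lim"
  unfolding play_measure_def ..

text \<open>The total mass is seen on the marginal over the empty set of stages, which is a
  probability measure.\<close>

lemma prob_space_play: "prob_space (play_measure X A p \<pi> x\<^sub>0)"
proof -
  have "prob_space (IT.CI {})"
    by (rule IT.PF.prob_space_P) auto
  then have "prob_space (distr IT.PF.lim (PiM {} (\<lambda>_. S)) (\<lambda>\<omega>. restrict \<omega> {}))"
    by (subst IT.distr_lim) auto
  moreover have "(\<lambda>\<omega>. restrict \<omega> {}) \<in> IT.PF.lim \<rightarrow>\<^sub>M PiM {} (\<lambda>_. S)"
    unfolding measurable_cong_sets[OF IT.PF.sets_lim refl] by (rule measurable_restrict_subset) simp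
  ultimately show ?thesis
    unfolding play_measure by (metis prob_space_distrD)
qed

lemma sets_play: "sets (play_measure X A p \<pi> x\<^sub>0) = sets (PiM UNIV (\<lambda>_. S))"
  by (simp add: play_measure)

lemma integral_play:
  fixes f :: "_ \<Rightarrow> real"
  assumes f: "f \<in> borel_measurable S" "\<And>z. z \<in> space S \<Longrightarrow> \<bar>f z\<bar> \<le> B"
  shows "(\<integral>\<omega>. f (\<omega> t) \<partial>play_measure X A p \<pi> x\<^sub>0) = stage_expectation t f"
proof -
  have m: "(\<lambda>\<omega>. f (\<omega> t)) \<in> borel_measurable (H (Suc t))"
    by (rule measurable_compose[OF _ f(1)]) (rule measurable_component_singleton, simp)
  have r: "(\<lambda>\<omega>. restrict \<omega> {0..<Suc t}) \<in> IT.PF.lim \<rightarrow>\<^sub>M H (Suc t)"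
    unfolding measurable_cong_sets[OF IT.PF.sets_lim refl] by (rule measurable_restrict_subset) simp
  \<comment> \<open>\<open>IT.CI J\<close> is the marginal on \<open>J\<close> of the law of the
    first \<open>up_to J\<close> stages; this number has to be identified before the history law
    appears.\<close>
  have up: "IT.up_to {0..<Suc t} = Suc t"
  proof (rule antisym)
    show "IT.up_to {0..<Suc t} \<le> Suc t" by (subst IT.up_to_iff_Ico) auto
    have "t < IT.up_to {0..<Suc t}" by (rule IT.up_to_less) auto
    then show "Suc t \<le> IT.up_to {0..<Suc t}" by (rule Suc_leI)
  qed
  have "(\<integral>\<omega>. f (\<omega> t) \<partial>IT.PF.lim) = (\<integral>\<omega>. f (\<omega> t) \<partial>distr IT.PF.lim (H (Suc t)) (\<lambda>\<omega>. restrict \<omega> {0..<Suc t}))"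
    by (subst integral_distr[OF r m]) simp
  also have "\<dots> = (\<integral>\<omega>. f (\<omega> t) \<partial>IT.CI {0..<Suc t})"
    by (simp add: IT.distr_lim)
  also have "\<dots> = (\<integral>\<omega>. f (restrict \<omega> {0..<Suc t} t) \<partial>P\<^sub>H (Suc t))"
    unfolding IT.CI_def up
    by (rule integral_distr[OF _ m]) (rule measurable_history, rule measurable_restrict_subset, simp)
  also have "\<dots> = stage_expectation t f"
    using integral_history_last[OF f] by simp
  finally show ?thesis by (simp add: play_measure)
qed

text \<open>The bound on \<open>c\<close> dominates the series by a geometric one, so sum and
  expectation may be exchanged. The resulting series of stage expectations is the form in which
  costs can be telescoped.\<close>

lemma discounted_cost_eq:
  assumes \<alpha>: "0 < \<alpha>" "\<alpha> < 1"
    and c: "c \<in> borel_measurable S" "\<And>z. z \<in> space S \<Longrightarrow> \<bar>c z\<bar> \<le> B"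
  shows "(\<lambda>t. \<alpha> ^ t * ((1 - \<alpha>) * stage_expectation t c)) sums discounted_cost X A p \<alpha> c \<pi> x\<^sub>0"
proof -
  let ?P = "play_measure X A p \<pi> x\<^sub>0"
  interpret P: prob_space ?P by (rule prob_space_play)
  have sp: "space ?P = space (PiM UNIV (\<lambda>_. S))"
    using sets_play by (rule sets_eq_imp_space_eq)
  have bnd: "\<bar>c (\<omega> t)\<bar> \<le> B" if "\<omega> \<in> space ?P" for \<omega> t
    using that by (intro c(2)) (auto simp: sp space_PiM)
  have m: "(\<lambda>\<omega>. c (\<omega> t)) \<in> borel_measurable ?P" for t
    unfolding measurable_cong_sets[OF sets_play refl]
    by (rule measurable_compose[OF _ c(1)]) (rule measurable_component_singleton, simp)
  have int: "integrable ?P (\<lambda>\<omega>. c (\<omega> t))" for t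
    by (rule P.integrable_const_bound[of _ B, OF _ m]) (use bnd in auto)
  have le: "norm (\<alpha> ^ t * c (\<omega> t)) \<le> \<alpha> ^ t * B" if "\<omega> \<in> space ?P" for \<omega> t
    using bnd[OF that, of t] \<alpha> by (simp add: abs_mult)
  have geo: "summable (\<lambda>t. \<alpha> ^ t * B)"
    using \<alpha> by (intro summable_mult2 summable_geometric) auto
  have "(\<lambda>t. \<integral>\<omega>. \<alpha> ^ t * c (\<omega> t) \<partial>?P) sums (\<integral>\<omega>. (\<Sum>t. \<alpha> ^ t * c (\<omega> t)) \<partial>?P)"
  proof (rule sums_integral)
    show "integrable ?P (\<lambda>\<omega>. \<alpha> ^ t * c (\<omega> t))" for t
      by (intro integrable_mult_right int)
    show "AE \<omega> in ?P. summable (\<lambda>t. norm (\<alpha> ^ t * c (\<omega> t)))"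
      using le by (intro AE_I2 summable_comparison_test[OF _ geo]) auto
    have "norm (\<integral>\<omega>. norm (\<alpha> ^ t * c (\<omega> t)) \<partial>?P) \<le> \<alpha> ^ t * B" for t
    proof -
      have "\<bar>\<integral>\<omega>. norm (\<alpha> ^ t * c (\<omega> t)) \<partial>?P\<bar> \<le> \<alpha> ^ t * B"
        by (rule abs_integral_le_const[OF prob_space_play]) (use le m in \<open>auto intro!: borel_measurable_times\<close>)
      then show ?thesis by simp
    qed
    then show "summable (\<lambda>t. \<integral>\<omega>. norm (\<alpha> ^ t * c (\<omega> t)) \<partial>?P)"
      by (intro summable_comparison_test[OF _ geo]) blast
  qed
  moreover have "(\<integral>\<omega>. \<alpha> ^ t * c (\<omega> t) \<partial>?P) = \<alpha> ^ t * stage_expectation t c" for t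
    using integral_play[OF c, of t] by simp
  ultimately have "(\<lambda>t. (1 - \<alpha>) * (\<alpha> ^ t * stage_expectation t c)) sums discounted_cost X A p \<alpha> c \<pi> x\<^sub>0"
    unfolding discounted_cost_def by (intro sums_mult) (simp only:)
  then show ?thesis by (simp add: algebra_simps)
qed

section \<open>From one-step inequalities to bounds on the discounted cost\<close>

lemma stage_expectation_mono:
  fixes f g :: "_ \<Rightarrow> real"
  assumes f: "f \<in> borel_measurable S" "\<And>z. z \<in> space S \<Longrightarrow> \<bar>f z\<bar> \<le> B"
    and g: "g \<in> borel_measurable S" "\<And>z. z \<in> space S \<Longrightarrow> \<bar>g z\<bar> \<le> B"
    and le: "\<And>\<omega>. \<omega> \<in> space (H t) \<Longrightarrow> (\<integral>z. f z \<partial>\<kappa> t \<omega>) - \<eta> \<le> (\<integral>z. g z \<partial>\<kappa> t \<omega>)"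
  shows "stage_expectation t f - \<eta> \<le> stage_expectation t g"
proof -
  interpret P: prob_space "P\<^sub>H t" by (rule history_law)
  have int: "integrable (P\<^sub>H t) (\<lambda>\<omega>. \<integral>z. h z \<partial>\<kappa> t \<omega>)"
    if h: "h \<in> borel_measurable S" "\<And>z. z \<in> space S \<Longrightarrow> \<bar>h z\<bar> \<le> B" for h :: "_ \<Rightarrow> real"
  proof (rule P.integrable_const_bound)
    have "\<bar>\<integral>z. h z \<partial>\<kappa> t \<omega>\<bar> \<le> B" if \<omega>: "\<omega> \<in> space (H t)" for \<omega>
      by (rule abs_integral_le_const)
        (use kernelD[OF measurable_stage_kernel \<omega>] h in \<open>simp_all add: measurable_cong_sets[OF kernelD(2)[OF measurable_stage_kernel \<omega>] refl]\<close>)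
    then show "AE \<omega> in P\<^sub>H t. norm (\<integral>z. h z \<partial>\<kappa> t \<omega>) \<le> B"
      by (intro AE_I2) (simp add: history_law)
    show "(\<lambda>\<omega>. \<integral>z. h z \<partial>\<kappa> t \<omega>) \<in> borel_measurable (P\<^sub>H t)"
      by (rule measurable_history, rule measurable_integral_kernel[OF measurable_stage_kernel h(1)])
  qed
  have "(\<integral>\<omega>. (\<integral>z. f z \<partial>\<kappa> t \<omega>) - \<eta> \<partial>P\<^sub>H t) \<le> (\<integral>\<omega>. \<integral>z. g z \<partial>\<kappa> t \<omega> \<partial>P\<^sub>H t)"
    by (rule integral_mono) (use int f g le in \<open>auto simp: history_law\<close>)
  then show ?thesis
    using int[OF f] by (simp add: stage_expectation_def P.prob_space)
qed

text \<open>Iterating the one-step inequality telescopes: the discounted sum of the stage costs and the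
  terms \<open>\<alpha>\<^bsup>t\<^esup> V\<close> of the states cancel up to \<open>\<eta>\<close> per stage.\<close>

lemma discounted_cost_lower_bound:
  assumes \<alpha>: "0 < \<alpha>" "\<alpha> < 1"
    and c: "c \<in> borel_measurable S" "\<And>z. z \<in> space S \<Longrightarrow> \<bar>c z\<bar> \<le> B"
    and V: "V \<in> borel_measurable X" "\<And>y. y \<in> space X \<Longrightarrow> \<bar>V y\<bar> \<le> B"
    and step: "\<And>t \<omega> y. \<omega> \<in> space (H t) \<Longrightarrow> y \<in> space X \<Longrightarrow>
      V y - \<eta> \<le> (\<integral>a. (1 - \<alpha>) * c (y, a) + \<alpha> * (\<integral>z. V z \<partial>p (y, a)) \<partial>PiM UNIV (\<lambda>i. \<pi> i t (\<omega>, y)))"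
  shows "V x\<^sub>0 - \<eta> / (1 - \<alpha>) \<le> discounted_cost X A p \<alpha> c \<pi> x\<^sub>0"
proof -
  define E where "E = stage_expectation"
  define W where "W z = (\<integral>y. V y \<partial>p z)" for z
  define u where "u z = (1 - \<alpha>) * c z + \<alpha> * W z" for z
  have W: "W \<in> borel_measurable S"
    unfolding W_def by (rule measurable_integral_kernel[OF transition V(1)])
  have Wb: "\<bar>W z\<bar> \<le> B" if "z \<in> space S" for z
    unfolding W_def
    by (rule abs_integral_le_const)
      (use kernelD[OF transition that] V in \<open>simp_all add: measurable_cong_sets[OF kernelD(2)[OF transition that] refl]\<close>)
  have u: "u \<in> borel_measurable S"
    unfolding u_def using c W by measurable
  have ub: "\<bar>u z\<bar> \<le> B" if "z \<in> space S" for z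
  proof -
    have "\<bar>u z\<bar> \<le> (1 - \<alpha>) * \<bar>c z\<bar> + \<alpha> * \<bar>W z\<bar>"
      unfolding u_def using \<alpha> by (intro order.trans[OF abs_triangle_ineq]) (simp add: abs_mult)
    also have "\<dots> \<le> (1 - \<alpha>) * B + \<alpha> * B"
      using \<alpha> c(2)[OF that] Wb[OF that] by (intro add_mono mult_left_mono) auto
    finally show ?thesis by (simp add: algebra_simps)
  qed
  have V1: "(\<lambda>z. V (fst z)) \<in> borel_measurable S"
    unfolding state_actions_def by (rule measurable_compose[OF measurable_fst V(1)])
  have V1b: "\<bar>V (fst z)\<bar> \<le> B" if "z \<in> space S" for z
    using that V(2) by (auto simp: state_actions_def space_pair_measure)
  have state_integral: "(\<integral>z. V (fst z) \<partial>\<kappa> t \<omega>) = (\<integral>y. V y \<partial>state_law t \<omega>)" if \<omega>: "\<omega> \<in> space (H t)" for t \<omega>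
  proof -
    have inner: "(\<integral>a. V (fst (y, a)) \<partial>PiM UNIV (\<lambda>i. \<pi> i t (\<omega>, y))) = V y" if "y \<in> space (state_law t \<omega>)" for y
    proof -
      have "(\<omega>, y) \<in> space (H t \<Otimes>\<^sub>M X)"
        using that \<omega> kernelD(3)[OF measurable_state_law \<omega>] by (simp add: space_pair_measure)
      from kernelD(1)[OF measurable_joint_law this] show ?thesis
        by (simp add: prob_space.prob_space)
    qed
    have "(\<integral>z. V (fst z) \<partial>\<kappa> t \<omega>) =
        (\<integral>y. \<integral>a. V (fst (y, a)) \<partial>PiM UNIV (\<lambda>i. \<pi> i t (\<omega>, y)) \<partial>state_law t \<omega>)"
      by (rule integral_stage_kernel[OF \<omega> V1 V1b])
    also have "\<dots> = (\<integral>y. V y \<partial>state_law t \<omega>)"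
      by (rule Bochner_Integration.integral_cong[OF refl inner])
    finally show ?thesis .
  qed
  have one_step: "E t (\<lambda>z. V (fst z)) - \<eta> \<le> E t u" for t
    unfolding E_def
  proof (rule stage_expectation_mono[OF V1 V1b u ub])
    fix \<omega> assume \<omega>: "\<omega> \<in> space (H t)"
    note law = kernelD[OF measurable_state_law \<omega>]
    interpret P: prob_space "state_law t \<omega>" by (rule law)
    have Vi: "integrable (state_law t \<omega>) V"
      using V law by (intro P.integrable_const_bound[of _ B] AE_I2) (simp_all add: measurable_cong_sets[OF law(2) refl])
    have choice: "(\<lambda>y. PiM UNIV (\<lambda>i. \<pi> i t (\<omega>, y))) \<in> X \<rightarrow>\<^sub>M prob_algebra (joint_actions A)"
      using measurable_compose[OF measurable_Pair1'[OF \<omega>] measurable_joint_law] by simp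
    define U where "U y = (\<integral>a. u (y, a) \<partial>PiM UNIV (\<lambda>i. \<pi> i t (\<omega>, y)))" for y
    have Uge: "V y - \<eta> \<le> U y" if "y \<in> space X" for y
      unfolding U_def u_def W_def by (rule step[OF \<omega> that])
    \<comment> \<open>Measurability comes from the choice kernel: the inner integral is also an
      integral over the law of the pair \<open>(y, a)\<close>, which depends measurably on
      \<open>y\<close>.\<close>
    have Um: "U \<in> borel_measurable X"
    proof -
      have "(\<lambda>y. \<integral>z. u z \<partial>distr (PiM UNIV (\<lambda>i. \<pi> i t (\<omega>, y))) S (\<lambda>a. (y, a))) \<in> borel_measurable X"
        using measurable_integral_kernel[OF measurable_compose[OF measurable_Pair1'[OF \<omega>] measurable_choice] u] by simp
      moreover have "(\<integral>z. u z \<partial>distr (PiM UNIV (\<lambda>i. \<pi> i t (\<omega>, y))) S (\<lambda>a. (y, a))) = U y" if y: "y \<in> space X" for y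
        unfolding U_def
      proof (rule integral_distr[OF _ u])
        show "Pair y \<in> PiM UNIV (\<lambda>i. \<pi> i t (\<omega>, y)) \<rightarrow>\<^sub>M S"
          unfolding measurable_cong_sets[OF kernelD(2)[OF choice y] refl] state_actions_def by (rule measurable_Pair1'[OF y])
      qed
      ultimately show ?thesis by (simp cong: measurable_cong)
    qed
    have Ub: "\<bar>U y\<bar> \<le> B" if y: "y \<in> space X" for y
      unfolding U_def
    proof (rule abs_integral_le_const[OF kernelD(1)[OF choice y]])
      show "(\<lambda>a. u (y, a)) \<in> borel_measurable (PiM UNIV (\<lambda>i. \<pi> i t (\<omega>, y)))"
        unfolding measurable_cong_sets[OF kernelD(2)[OF choice y] refl]
        by (rule measurable_compose[OF _ u]) (simp add: state_actions_def y)
      show "\<bar>u (y, a)\<bar> \<le> B" if "a \<in> space (PiM UNIV (\<lambda>i. \<pi> i t (\<omega>, y)))" for a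
        using that y unfolding kernelD(3)[OF choice y]
        by (intro ub) (simp add: state_actions_def space_pair_measure)
    qed
    have Ui: "integrable (state_law t \<omega>) U"
      using Um Ub law by (intro P.integrable_const_bound[of _ B] AE_I2) (simp_all add: measurable_cong_sets[OF law(2) refl])
    have "(\<integral>z. V (fst z) \<partial>\<kappa> t \<omega>) - \<eta> = (\<integral>y. V y - \<eta> \<partial>state_law t \<omega>)"
      using Vi by (simp add: state_integral[OF \<omega>] P.prob_space)
    also have "\<dots> \<le> (\<integral>y. U y \<partial>state_law t \<omega>)"
      by (rule integral_mono) (use Vi Ui Uge law in auto)
    also have "\<dots> = (\<integral>z. u z \<partial>\<kappa> t \<omega>)"
      unfolding U_def by (rule integral_stage_kernel[OF \<omega> u ub, symmetric])
    finally show "(\<integral>z. V (fst z) \<partial>\<kappa> t \<omega>) - \<eta> \<le> (\<integral>z. u z \<partial>\<kappa> t \<omega>)" .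
  qed
  \<comment> \<open>The state law at \<open>Suc t\<close> reads only the pair number
    \<open>t\<close>, so conditioning on the first \<open>Suc t\<close> pairs replaces the value of
    the next state by \<open>W\<close> of the last pair.\<close>
  have next_state: "E (Suc t) (\<lambda>z. V (fst z)) = E t W" for t
  proof -
    have "E (Suc t) (\<lambda>z. V (fst z)) = (\<integral>\<omega>. W (\<omega> t) \<partial>P\<^sub>H (Suc t))"
      unfolding E_def stage_expectation_def
    proof (intro Bochner_Integration.integral_cong refl)
      fix \<omega> assume "\<omega> \<in> space (P\<^sub>H (Suc t))"
      then have "\<omega> \<in> space (H (Suc t))" by (simp only: history_law)
      from state_integral[OF this] show "(\<integral>z. V (fst z) \<partial>\<kappa> (Suc t) \<omega>) = W (\<omega> t)"
        by (simp add: state_law_def W_def)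
    qed
    also have "\<dots> = E t W"
      unfolding E_def by (rule integral_history_last[OF W Wb])
    finally show ?thesis .
  qed
  \<comment> \<open>Linearity is taken from the single integral over the play measure instead of the
    nested integrals in \<open>stage_expectation\<close>.\<close>
  have lin: "E t u = (1 - \<alpha>) * E t c + \<alpha> * E t W" for t
  proof -
    interpret P: prob_space "play_measure X A p \<pi> x\<^sub>0" by (rule prob_space_play)
    have sp: "space (play_measure X A p \<pi> x\<^sub>0) = space (PiM UNIV (\<lambda>_. S))"
      using sets_play by (rule sets_eq_imp_space_eq)
    have int: "integrable (play_measure X A p \<pi> x\<^sub>0) (\<lambda>\<omega>. h (\<omega> t))"
      if h: "h \<in> borel_measurable S" "\<And>z. z \<in> space S \<Longrightarrow> \<bar>h z\<bar> \<le> B" for h :: "_ \<Rightarrow> real"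
    proof (rule P.integrable_const_bound[of _ B])
      show "AE \<omega> in play_measure X A p \<pi> x\<^sub>0. norm (h (\<omega> t)) \<le> B"
        unfolding real_norm_def by (intro AE_I2 h(2)) (auto simp: sp space_PiM)
      show "(\<lambda>\<omega>. h (\<omega> t)) \<in> borel_measurable (play_measure X A p \<pi> x\<^sub>0)"
        unfolding measurable_cong_sets[OF sets_play refl]
        by (rule measurable_compose[OF _ h(1)]) (rule measurable_component_singleton, simp)
    qed
    let ?I = "\<lambda>h. \<integral>\<omega>. h (\<omega> t) \<partial>play_measure X A p \<pi> x\<^sub>0"
    have "?I u = E t u" "?I c = E t c" "?I W = E t W"
      unfolding E_def by (rule integral_play[OF u ub] integral_play[OF c] integral_play[OF W Wb]; assumption)+
    moreover have "integrable (play_measure X A p \<pi> x\<^sub>0) (\<lambda>\<omega>. c (\<omega> t))"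
      "integrable (play_measure X A p \<pi> x\<^sub>0) (\<lambda>\<omega>. W (\<omega> t))"
      by (rule int[OF c] int[OF W Wb]; assumption)+
    then have "?I u = (1 - \<alpha>) * ?I c + \<alpha> * ?I W"
      by (simp add: u_def)
    ultimately show ?thesis by simp
  qed
  have init: "E 0 (\<lambda>z. V (fst z)) = V x\<^sub>0"
  proof -
    have "E 0 (\<lambda>z. V (fst z)) = (\<integral>\<omega>. V x\<^sub>0 \<partial>P\<^sub>H 0)"
      unfolding E_def stage_expectation_def
    proof (intro Bochner_Integration.integral_cong refl)
      fix \<omega> assume "\<omega> \<in> space (P\<^sub>H 0)"
      then have "\<omega> \<in> space (H 0)" by (simp only: history_law)
      from state_integral[OF this] show "(\<integral>z. V (fst z) \<partial>\<kappa> 0 \<omega>) = V x\<^sub>0"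
        by (simp add: state_law_def integral_return[OF initial V(1)])
    qed
    also have "\<dots> = V x\<^sub>0"
      using prob_space.prob_space[OF history_law(1)[of 0]] by simp
    finally show ?thesis .
  qed
  define w where "w t = E t (\<lambda>z. V (fst z))" for t
  have stage: "w t - \<eta> \<le> (1 - \<alpha>) * E t c + \<alpha> * w (Suc t)" for t
    using one_step[of t] by (simp add: w_def lin next_state)
  have tele: "V x\<^sub>0 - \<alpha> ^ n * w n - \<eta> * (\<Sum>t<n. \<alpha> ^ t) \<le> (\<Sum>t<n. \<alpha> ^ t * ((1 - \<alpha>) * E t c))" for n
  proof (induction n)
    case 0
    then show ?case by (simp add: w_def init)
  next
    case (Suc n)
    have "\<alpha> ^ n * (w n - \<eta>) \<le> \<alpha> ^ n * ((1 - \<alpha>) * E n c + \<alpha> * w (Suc n))"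
      using stage[of n] \<alpha> by (intro mult_left_mono) auto
    with Suc show ?case by (simp add: algebra_simps)
  qed
  have wb: "\<bar>w t\<bar> \<le> B" for t
  proof -
    have "\<bar>\<integral>\<omega>. V (fst (\<omega> t)) \<partial>play_measure X A p \<pi> x\<^sub>0\<bar> \<le> B"
    proof (rule abs_integral_le_const[OF prob_space_play])
      show "(\<lambda>\<omega>. V (fst (\<omega> t))) \<in> borel_measurable (play_measure X A p \<pi> x\<^sub>0)"
        unfolding measurable_cong_sets[OF sets_play refl]
        by (rule measurable_compose[OF _ V1]) (rule measurable_component_singleton, simp)
      show "\<bar>V (fst (\<omega> t))\<bar> \<le> B" if "\<omega> \<in> space (play_measure X A p \<pi> x\<^sub>0)" for \<omega>
        using that V1b[of "\<omega> t"] unfolding sets_eq_imp_space_eq[OF sets_play] by (auto simp: space_PiM)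
    qed
    moreover have "(\<integral>\<omega>. V (fst (\<omega> t)) \<partial>play_measure X A p \<pi> x\<^sub>0) = w t"
      unfolding w_def E_def by (rule integral_play[OF V1 V1b])
    ultimately show ?thesis by simp
  qed
  \<comment> \<open>The boundary term of the telescoped sum vanishes since \<open>V\<close> is
    bounded by \<open>B\<close>.\<close>
  have w0: "(\<lambda>n. \<alpha> ^ n * w n) \<longlonglongrightarrow> 0"
  proof (rule Lim_null_comparison)
    show "\<forall>\<^sub>F n in sequentially. norm (\<alpha> ^ n * w n) \<le> \<alpha> ^ n * B"
      using wb \<alpha> by (auto simp: abs_mult)
    show "(\<lambda>n. \<alpha> ^ n * B) \<longlonglongrightarrow> 0"
      using \<alpha> by (intro tendsto_mult_left_zero LIMSEQ_power_zero) auto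
  qed
  \<comment> \<open>This series is the source of the factor in
    \<open>\<eta> / (1 - \<alpha>)\<close>: an error \<open>\<eta>\<close> at every stage is
    discounted along with the stage.\<close>
  have geo: "(\<lambda>t. \<alpha> ^ t) sums (1 / (1 - \<alpha>))"
    using \<alpha> by (intro geometric_sums) auto
  have "(\<lambda>n. V x\<^sub>0 - \<alpha> ^ n * w n - \<eta> * (\<Sum>t<n. \<alpha> ^ t)) \<longlonglongrightarrow> V x\<^sub>0 - 0 - \<eta> * (1 / (1 - \<alpha>))"
    using geo unfolding sums_def by (intro tendsto_intros w0)
  moreover have "(\<lambda>n. \<Sum>t<n. \<alpha> ^ t * ((1 - \<alpha>) * E t c)) \<longlonglongrightarrow> discounted_cost X A p \<alpha> c \<pi> x\<^sub>0"
    using discounted_cost_eq[OF \<alpha> c] unfolding sums_def E_def .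
  ultimately show ?thesis
    using tele by (intro LIMSEQ_le[where X = "\<lambda>n. V x\<^sub>0 - \<alpha> ^ n * w n - \<eta> * (\<Sum>t<n. \<alpha> ^ t)"]) (auto simp: E_def)
qed

text \<open>Changing the signs of \<open>c\<close> and \<open>V\<close> turns the reversed one-step
  inequality into the hypothesis of the lower bound.\<close>

lemma discounted_cost_upper_bound:
  assumes \<alpha>: "0 < \<alpha>" "\<alpha> < 1"
    and c: "c \<in> borel_measurable S" "\<And>z. z \<in> space S \<Longrightarrow> \<bar>c z\<bar> \<le> B"
    and V: "V \<in> borel_measurable X" "\<And>y. y \<in> space X \<Longrightarrow> \<bar>V y\<bar> \<le> B"
    and step: "\<And>t \<omega> y. \<omega> \<in> space (H t) \<Longrightarrow> y \<in> space X \<Longrightarrow>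
      (\<integral>a. (1 - \<alpha>) * c (y, a) + \<alpha> * (\<integral>z. V z \<partial>p (y, a)) \<partial>PiM UNIV (\<lambda>i. \<pi> i t (\<omega>, y))) \<le> V y + \<eta>"
  shows "discounted_cost X A p \<alpha> c \<pi> x\<^sub>0 \<le> V x\<^sub>0 + \<eta> / (1 - \<alpha>)"
proof -
  have c': "(\<lambda>z. - c z) \<in> borel_measurable S" "\<And>z. z \<in> space S \<Longrightarrow> \<bar>- c z\<bar> \<le> B"
    using c by auto
  have "(\<lambda>t. - (\<alpha> ^ t * ((1 - \<alpha>) * stage_expectation t c))) sums discounted_cost X A p \<alpha> (\<lambda>z. - c z) \<pi> x\<^sub>0"
    using discounted_cost_eq[OF \<alpha> c'] by (simp add: stage_expectation_def)
  with sums_minus[OF discounted_cost_eq[OF \<alpha> c]]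
  have eq: "discounted_cost X A p \<alpha> (\<lambda>z. - c z) \<pi> x\<^sub>0 = - discounted_cost X A p \<alpha> c \<pi> x\<^sub>0"
    by (rule sums_unique2[symmetric])
  have "- V x\<^sub>0 - \<eta> / (1 - \<alpha>) \<le> discounted_cost X A p \<alpha> (\<lambda>z. - c z) \<pi> x\<^sub>0"
  proof (rule discounted_cost_lower_bound[OF \<alpha> c', where V = "\<lambda>y. - V y"])
    fix t \<omega> y assume "\<omega> \<in> space (H t)" "y \<in> space X"
    from step[OF this] show "- V y - \<eta> \<le> (\<integral>a. (1 - \<alpha>) * - c (y, a) + \<alpha> * (\<integral>z. - V z \<partial>p (y, a)) \<partial>PiM UNIV (\<lambda>i. \<pi> i t (\<omega>, y)))"
      using Bochner_Integration.integral_minus[of "PiM UNIV (\<lambda>i. \<pi> i t (\<omega>, y))" "\<lambda>a. (1 - \<alpha>) * c (y, a) + \<alpha> * (\<integral>z. V z \<partial>p (y, a))"]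
      by simp
  qed (use V in auto)
  then show ?thesis by (simp add: eq)
qed

end

section \<open>Separability of \<open>L\<^sup>1\<close>\<close>

lemma L1_triangle:
  fixes f g h :: "'b \<Rightarrow> real"
  assumes "integrable M f" "integrable M g" "integrable M h"
  shows "(\<integral>x. \<bar>f x - h x\<bar> \<partial>M) \<le> (\<integral>x. \<bar>f x - g x\<bar> \<partial>M) + (\<integral>x. \<bar>g x - h x\<bar> \<partial>M)"
proof -
  have "(\<integral>x. \<bar>f x - h x\<bar> \<partial>M) \<le> (\<integral>x. \<bar>f x - g x\<bar> + \<bar>g x - h x\<bar> \<partial>M)"
    using assms by (intro integral_mono) auto
  then show ?thesis using assms by simp
qed

text \<open>Rational step functions over a countable generating family form a countable set. Its
  closure contains the indicators of the family, then of all measurable sets by Dynkin induction,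
  then all integrable functions by approximation with simple ones.\<close>

lemma (in finite_measure) L1_separable:
  assumes "countably_generated X" and sets_eq: "sets M = sets X"
  shows "\<exists>g :: nat \<Rightarrow> 'a \<Rightarrow> real. (\<forall>n. integrable M (g n)) \<and>
    (\<forall>f. integrable M f \<longrightarrow> (\<forall>e>0. \<exists>n. (\<integral>x. \<bar>f x - g n x\<bar> \<partial>M) < e))"
proof -
  obtain G where G: "countable G" "G \<subseteq> Pow (space X)" "sets X = sigma_sets (space X) G"
    using assms by (auto simp: countably_generated_def)
  have sp: "space M = space X" using sets_eq by (rule sets_eq_imp_space_eq)
  \<comment> \<open>Finite intersections make the generator intersection-stable, as Dynkin induction
    requires, and keep it countable. The factor \<open>space M\<close> gives the empty intersection
    the value \<open>space M\<close>.\<close>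
  define G' where "G' = (\<lambda>F. space M \<inter> \<Inter>F) ` {F. finite F \<and> F \<subseteq> G}"
  have cG': "countable G'"
    unfolding G'_def using G(1) by (intro countable_image countable_Collect_finite_subset)
  have G'_sets: "G' \<subseteq> sets M"
  proof
    fix B assume "B \<in> G'"
    then obtain F where F: "finite F" "F \<subseteq> G" "B = space M \<inter> \<Inter>F" by (auto simp: G'_def)
    have "F \<subseteq> sets M" using F(2) G(3) sets_eq by auto
    with F(1) have "space M \<inter> \<Inter>F \<in> sets M" by (induction F) (auto simp: Int_left_commute)
    then show "B \<in> sets M" using F(3) by simp
  qed
  have G'_Pow: "G' \<subseteq> Pow (space M)" using G'_sets sets.sets_into_space by auto
  have "Int_stable G'"
  proof (rule Int_stableI)
    fix B B' assume "B \<in> G'" "B' \<in> G'"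
    then obtain F F' where "finite F" "F \<subseteq> G" "B = space M \<inter> \<Inter>F" "finite F'" "F' \<subseteq> G" "B' = space M \<inter> \<Inter>F'"
      by (auto simp: G'_def)
    then show "B \<inter> B' \<in> G'"
      unfolding G'_def by (intro image_eqI[of _ _ "F \<union> F'"]) auto
  qed
  have gen: "sets M = sigma_sets (space M) G'"
  proof (rule antisym)
    have "G \<subseteq> G'"
      unfolding G'_def using G(2) by (intro subsetI image_eqI[of _ _ "{_}"]) (auto simp: sp)
    then show "sets M \<subseteq> sigma_sets (space M) G'"
      unfolding sets_eq G(3) sp by (rule sigma_sets_mono')
    show "sigma_sets (space M) G' \<subseteq> sets M"
      using G'_sets by (rule sets.sigma_sets_subset)
  qed
  \<comment> \<open>Step functions are coded by lists of coefficients and sets: appending lists adds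
    the functions, and there are only countably many lists over a countable family.\<close>
  define s where "s l x = (\<Sum>(q, B)\<leftarrow>l. real_of_rat q * indicator B x)" for l :: "(rat \<times> 'a set) list" and x
  define Ls where "Ls = lists ((UNIV :: rat set) \<times> G')"
  have cL: "countable Ls" "Ls \<noteq> {}"
    unfolding Ls_def using cG' by (intro countable_lists countable_SIGMA countableI_type) auto
  have s_int: "integrable M (s l)" if "l \<in> Ls" for l
    using that unfolding Ls_def
  proof (induction l)
    case (Cons a l)
    then have "integrable M (\<lambda>x. real_of_rat (fst a) * indicator (snd a) x)"
      using G'_sets by (intro integrable_mult_right integrable_real_indicator) (auto simp: less_top[symmetric])
    with Cons show ?case by (auto simp: s_def[abs_def] case_prod_beta)
  qed (simp add: s_def[abs_def])
  define D where "D f \<longleftrightarrow> integrable M f \<and> (\<forall>e>0. \<exists>l\<in>Ls. (\<integral>x. \<bar>f x - s l x\<bar> \<partial>M) < e)" for f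
  have D_s: "D (s l)" if "l \<in> Ls" for l
    using that s_int by (auto simp: D_def intro!: bexI[of _ l])
  \<comment> \<open>\<open>D\<close> describes the closure of the step functions, so it is itself
    closed. The harder cases below need only an approximation by members of \<open>D\<close>, not by
    step functions.\<close>
  have D_lim: "D f" if f: "integrable M f" and ap: "\<And>e. e > 0 \<Longrightarrow> \<exists>g. D g \<and> (\<integral>x. \<bar>f x - g x\<bar> \<partial>M) < e" for f
    unfolding D_def
  proof (intro conjI allI impI f)
    fix e :: real assume "e > 0"
    then obtain g where g: "D g" "(\<integral>x. \<bar>f x - g x\<bar> \<partial>M) < e / 2" using ap[of "e / 2"] by auto
    then obtain l where l: "l \<in> Ls" "(\<integral>x. \<bar>g x - s l x\<bar> \<partial>M) < e / 2"
      using \<open>e > 0\<close> unfolding D_def by (meson half_gt_zero)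
    show "\<exists>l\<in>Ls. (\<integral>x. \<bar>f x - s l x\<bar> \<partial>M) < e"
      using L1_triangle[OF f _ s_int[OF l(1)], of g] g l by (intro bexI[of _ l]) (auto simp: D_def)
  qed
  have D_add: "D (\<lambda>x. f x + g x)" if f: "D f" and g: "D g" for f g
    unfolding D_def
  proof (intro conjI allI impI)
    show "integrable M (\<lambda>x. f x + g x)" using f g by (auto simp: D_def)
    fix e :: real assume "e > 0"
    then obtain l l' where l: "l \<in> Ls" "(\<integral>x. \<bar>f x - s l x\<bar> \<partial>M) < e / 2"
      and l': "l' \<in> Ls" "(\<integral>x. \<bar>g x - s l' x\<bar> \<partial>M) < e / 2"
      using f g unfolding D_def by (meson half_gt_zero)
    have sa: "s (l @ l') x = s l x + s l' x" for x by (simp add: s_def)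
    have "(\<integral>x. \<bar>f x + g x - s (l @ l') x\<bar> \<partial>M) \<le> (\<integral>x. \<bar>f x - s l x\<bar> + \<bar>g x - s l' x\<bar> \<partial>M)"
      using f g s_int[OF l(1)] s_int[OF l'(1)]
      by (intro integral_mono) (auto simp: D_def sa)
    also have "\<dots> < e"
      using f g s_int[OF l(1)] s_int[OF l'(1)] l l' by (subst Bochner_Integration.integral_add) (auto simp: D_def)
    finally show "\<exists>l\<in>Ls. (\<integral>x. \<bar>f x + g x - s l x\<bar> \<partial>M) < e"
      using l(1) l'(1) by (intro bexI[of _ "l @ l'"]) (auto simp: Ls_def)
  qed
  have D_sum: "D (\<lambda>x. \<Sum>i<n. f i x)" if "\<And>i. D (f i)" for f :: "nat \<Rightarrow> 'a \<Rightarrow> real" and n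
  proof (induction n)
    case 0
    have "[] \<in> Ls" by (simp add: Ls_def)
    from D_s[OF this] show ?case by (simp add: s_def[abs_def])
  next
    case (Suc n)
    from D_add[OF this that[of n]] show ?case by simp
  qed
  have D_cong: "D g" if "D f" "\<And>x. x \<in> space M \<Longrightarrow> f x = g x" for f g
  proof -
    have "integrable M g" using that unfolding D_def by (metis Bochner_Integration.integrable_cong)
    moreover have "(\<integral>x. \<bar>g x - s l x\<bar> \<partial>M) = (\<integral>x. \<bar>f x - s l x\<bar> \<partial>M)" for l
      using that(2) by (intro Bochner_Integration.integral_cong) auto
    ultimately show ?thesis using that(1) by (simp add: D_def)
  qed
  have frac: "r * (e / (r + 1)) < e" if "r \<ge> 0" "e > 0" for r e :: real
    using that by (simp add: divide_simps)
  have D_scale: "D (\<lambda>x. c * f x)" if f: "D f" for c f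
  proof (rule D_lim)
    have fi: "integrable M f" using f by (simp add: D_def)
    then show "integrable M (\<lambda>x. c * f x)" by simp
    fix e :: real assume "e > 0"
    define I where "I = (\<integral>x. \<bar>f x\<bar> \<partial>M)"
    have "I \<ge> 0" unfolding I_def by simp
    \<comment> \<open>A real factor is approximated by rational ones, for which the coefficients in
      the list can be multiplied exactly. The summand 1 in \<open>I + 1\<close> avoids division by 0
      when \<open>f\<close> has norm 0.\<close>
    obtain q where q: "c < real_of_rat q" "real_of_rat q < c + e / (I + 1)"
      using of_rat_dense[of c "c + e / (I + 1)"] \<open>e > 0\<close> \<open>I \<ge> 0\<close> by auto
    have "D (\<lambda>x. real_of_rat q * f x)"
      unfolding D_def
    proof (intro conjI allI impI)
      show "integrable M (\<lambda>x. real_of_rat q * f x)" using fi by simp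
      fix e :: real assume "e > 0"
      then obtain l where l: "l \<in> Ls" "(\<integral>x. \<bar>f x - s l x\<bar> \<partial>M) < e / (\<bar>real_of_rat q\<bar> + 1)"
        using f unfolding D_def by (metis abs_ge_zero add_nonneg_pos divide_pos_pos zero_less_one)
      define l' where "l' = map (\<lambda>(r, B). (q * r, B)) l"
      have sl': "s l' x = real_of_rat q * s l x" for x
        unfolding s_def l'_def by (induction l) (auto simp: algebra_simps of_rat_mult)
      have "l' \<in> Ls" using l(1) by (auto simp: Ls_def l'_def)
      moreover have "(\<integral>x. \<bar>real_of_rat q * f x - s l' x\<bar> \<partial>M) = \<bar>real_of_rat q\<bar> * (\<integral>x. \<bar>f x - s l x\<bar> \<partial>M)"
        unfolding sl' by (simp add: abs_mult flip: right_diff_distrib)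
      moreover have "\<bar>real_of_rat q\<bar> * (\<integral>x. \<bar>f x - s l x\<bar> \<partial>M) \<le> \<bar>real_of_rat q\<bar> * (e / (\<bar>real_of_rat q\<bar> + 1))"
        using l(2) by (intro mult_left_mono) auto
      moreover have "\<bar>real_of_rat q\<bar> * (e / (\<bar>real_of_rat q\<bar> + 1)) < e"
        by (rule frac[OF abs_ge_zero \<open>e > 0\<close>])
      ultimately show "\<exists>l\<in>Ls. (\<integral>x. \<bar>real_of_rat q * f x - s l x\<bar> \<partial>M) < e"
        by (intro bexI[of _ l']) linarith+
    qed
    moreover have "(\<integral>x. \<bar>c * f x - real_of_rat q * f x\<bar> \<partial>M) = \<bar>c - real_of_rat q\<bar> * I"
      unfolding I_def by (simp add: abs_mult flip: left_diff_distrib)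
    moreover have "\<bar>c - real_of_rat q\<bar> * I < e"
    proof -
      have "\<bar>c - real_of_rat q\<bar> * I \<le> e / (I + 1) * I"
        using q \<open>I \<ge> 0\<close> by (intro mult_right_mono) auto
      also have "\<dots> < e" using \<open>e > 0\<close> \<open>I \<ge> 0\<close> by (simp add: divide_simps)
      finally show ?thesis .
    qed
    ultimately show "\<exists>g. D g \<and> (\<integral>x. \<bar>c * f x - g x\<bar> \<partial>M) < e"
      by (intro exI[of _ "\<lambda>x. real_of_rat q * f x"]) simp
  qed
  have D_basic: "D (indicator B :: 'a \<Rightarrow> real)" if "B \<in> G'" for B
    using D_s[of "[(1, B)]"] that by (simp add: s_def[abs_def] Ls_def)
  have D_ind: "D (indicator B :: 'a \<Rightarrow> real)" if "B \<in> sets M" for B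
  proof -
    have "B \<in> sigma_sets (space M) G'" using that gen by simp
    from \<open>Int_stable G'\<close> G'_Pow this show ?thesis
    proof (induction rule: sigma_sets_induct_disjoint)
      case (basic B)
      then show ?case by (rule D_basic)
    next
      case empty
      have "[] \<in> Ls" by (simp add: Ls_def)
      from D_s[OF this] show ?case by (simp add: s_def[abs_def] indicator_def[abs_def])
    next
      case (compl B)
      have "space M \<in> G'" unfolding G'_def by (intro image_eqI[of _ _ "{}"]) auto
      from D_add[OF D_basic[OF this] D_scale[OF compl.IH, of "-1"]]
      show ?case by (rule D_cong) (auto simp: indicator_def)
    next
      case (union B)
      have B: "B i \<in> sets M" for i using union(2) gen by auto
      have UB: "(\<Union>i. B i) \<in> sets M" using B by auto
      \<comment> \<open>By disjointness the remainder after \<open>n\<close> sets is the indicator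
        of a tail. It is nonnegative, so its norm is the remainder of the series of
        measures.\<close>
      have ind: "indicator (\<Union>i. B i) x - (\<Sum>i<n. indicator (B i) x) = (indicator (\<Union>i\<in>{n..}. B i) x :: real)" for n x
      proof (cases "x \<in> (\<Union>i. B i)")
        case True
        then obtain k where k: "x \<in> B k" by auto
        have iff: "x \<in> B i \<longleftrightarrow> i = k" for i using union(1) k unfolding disjoint_family_on_def by blast
        have "(\<Sum>i<n. indicator (B i) x :: real) = (\<Sum>i<n. if i = k then 1 else 0)"
          by (intro sum.cong) (auto simp: indicator_def iff)
        then show ?thesis using True by (auto simp: indicator_def iff)
      next
        case False
        then show ?thesis by (auto simp: indicator_def)
      qed
      show ?case
      proof (rule D_lim)
        show "integrable M (indicator (\<Union>i. B i) :: 'a \<Rightarrow> real)"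
          using UB by (intro integrable_real_indicator) (auto simp: less_top[symmetric])
        fix e :: real assume "e > 0"
        have "(\<lambda>i. measure M (B i)) sums measure M (\<Union>i. B i)"
          using B union(1) by (intro finite_measure_UNION) auto
        then have "(\<lambda>n. measure M (\<Union>i. B i) - (\<Sum>i<n. measure M (B i))) \<longlonglongrightarrow> measure M (\<Union>i. B i) - measure M (\<Union>i. B i)"
          unfolding sums_def by (intro tendsto_intros)
        then have "\<forall>\<^sub>F n in sequentially. measure M (\<Union>i. B i) - (\<Sum>i<n. measure M (B i)) < e"
          using \<open>e > 0\<close> by (intro order_tendstoD(2)) auto
        then obtain n where n: "measure M (\<Union>i. B i) - (\<Sum>i<n. measure M (B i)) < e"
          by (auto simp: eventually_sequentially)
        have "(\<integral>x. \<bar>indicator (\<Union>i. B i) x - (\<Sum>i<n. indicator (B i) x)\<bar> \<partial>M)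
            = (\<integral>x. indicator (\<Union>i. B i) x - (\<Sum>i<n. indicator (B i) x :: real) \<partial>M)"
          unfolding ind by simp
        also have "\<dots> = measure M (\<Union>i. B i) - (\<Sum>i<n. measure M (B i))"
          using B UB by (subst Bochner_Integration.integral_diff) (auto simp: less_top[symmetric] Int_absorb1 sets.sets_into_space)
        finally show "\<exists>g. D g \<and> (\<integral>x. \<bar>indicator (\<Union>i. B i) x - g x\<bar> \<partial>M) < e"
          using n D_sum[where n = n, OF union.IH] by (intro exI[of _ "\<lambda>x. \<Sum>i<n. indicator (B i) x"]) simp
      qed
    qed
  qed
  have D_all: "D f" if "integrable M f" for f :: "'a \<Rightarrow> real"
    using that
  proof (induction f rule: integrable_induct)
    case (base B c)
    from D_scale[OF D_ind[OF base(1)], of c] show ?case by (simp add: mult.commute)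
  next
    case (add f g)
    then show ?case using D_add by blast
  next
    case (lim f t)
    show ?case
    proof (rule D_lim[OF lim.hyps(4)])
      fix e :: real assume "e > 0"
      have "(\<lambda>i. \<integral>x. \<bar>f x - t i x\<bar> \<partial>M) \<longlonglongrightarrow> (\<integral>x. 0 \<partial>M)"
      proof (rule integral_dominated_convergence)
        \<comment> \<open>The approximants satisfy
          \<open>\<bar>t i x\<bar> \<le> 2 * \<bar>f x\<bar>\<close>, hence the factor 3.\<close>
        show "integrable M (\<lambda>x. 3 * \<bar>f x\<bar>)" using lim.hyps(4) by simp
        show "AE x in M. (\<lambda>i. \<bar>f x - t i x\<bar>) \<longlonglongrightarrow> 0"
        proof (rule AE_I2)
          fix x assume "x \<in> space M"
          then have "(\<lambda>i. \<bar>f x - t i x\<bar>) \<longlonglongrightarrow> \<bar>f x - f x\<bar>" using lim.hyps(2) by (intro tendsto_intros)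
          then show "(\<lambda>i. \<bar>f x - t i x\<bar>) \<longlonglongrightarrow> 0" by simp
        qed
        show "AE x in M. norm \<bar>f x - t i x\<bar> \<le> 3 * \<bar>f x\<bar>" for i
        proof (rule AE_I2)
          fix x assume "x \<in> space M"
          from lim.hyps(3)[OF this, of i] show "norm \<bar>f x - t i x\<bar> \<le> 3 * \<bar>f x\<bar>" by simp
        qed
      qed (use lim.hyps(1,4) in auto)
      then have "\<forall>\<^sub>F i in sequentially. (\<integral>x. \<bar>f x - t i x\<bar> \<partial>M) < e"
        using \<open>e > 0\<close> by (intro order_tendstoD(2)) auto
      then obtain i where "(\<integral>x. \<bar>f x - t i x\<bar> \<partial>M) < e"
        by (auto simp: eventually_sequentially)
      then show "\<exists>g. D g \<and> (\<integral>x. \<bar>f x - g x\<bar> \<partial>M) < e" using lim.IH(1) by blast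
    qed
  qed
  show ?thesis
  proof (intro exI[of _ "\<lambda>n. s (from_nat_into Ls n)"] conjI allI impI)
    show "integrable M (s (from_nat_into Ls n))" for n
      by (rule s_int[OF from_nat_into[OF cL(2)]])
    fix f :: "'a \<Rightarrow> real" and e :: real assume "integrable M f" "0 < e"
    then obtain l where l: "l \<in> Ls" "(\<integral>x. \<bar>f x - s l x\<bar> \<partial>M) < e"
      using D_all by (auto simp: D_def)
    then obtain n where "from_nat_into Ls n = l"
      using from_nat_into_surj[OF cL(1)] by blast
    then show "\<exists>n. (\<integral>x. \<bar>f x - s (from_nat_into Ls n) x\<bar> \<partial>M) < e" using l by (metis)
  qed
qed

section \<open>State types\<close>

text \<open>Finite nets of mesh \<open>1 / (m + 1)\<close> for all \<open>m\<close> are enumerated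
  in one sequence. The second property is stronger than density: an initial segment is already a
  net, so a finite supply of actions can be described by a bound on their indices.\<close>

lemma compact_dense_sequence:
  fixes A :: "'a::metric_space set"
  assumes "compact A" "A \<noteq> {}"
  obtains d :: "nat \<Rightarrow> 'a" where "\<And>j. d j \<in> A"
    and "\<And>e. 0 < e \<Longrightarrow> \<exists>k. \<forall>a\<in>A. \<exists>j<k. dist a (d j) < e"
proof -
  have "\<forall>m. \<exists>N. finite N \<and> N \<subseteq> A \<and> A \<subseteq> (\<Union>x\<in>N. ball x (1 / real (Suc m)))"
    using seq_compact_imp_totally_bounded[OF compact_imp_seq_compact[OF \<open>compact A\<close>]] by simp
  from choice[OF this] obtain N where N: "\<And>m. finite (N m)" "\<And>m. N m \<subseteq> A"
    "\<And>m. A \<subseteq> (\<Union>x\<in>N m. ball x (1 / real (Suc m)))"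
    by blast
  define U where "U = (\<Union>m. N m)"
  have "countable U"
    unfolding U_def using N(1) by (intro countable_UN countableI_type countable_finite)
  moreover have "U \<subseteq> A" unfolding U_def using N(2) by blast
  moreover have "U \<noteq> {}" unfolding U_def using N(3)[of 0] \<open>A \<noteq> {}\<close> by blast
  ultimately have U: "countable U" "U \<subseteq> A" "U \<noteq> {}" by auto
  show ?thesis
  proof (rule that[of "from_nat_into U"])
    show "from_nat_into U j \<in> A" for j
      using from_nat_into[OF U(3)] U(2) by auto
    fix e :: real assume "0 < e"
    then obtain m where m: "1 / real (Suc m) < e" using nat_approx_posE by blast
    have "N m \<subseteq> range (from_nat_into U)"
      using range_from_nat_into[OF U(3,1)] by (auto simp: U_def)
    from finite_subset_image[OF N(1) this] obtain C where C: "finite C" "N m = from_nat_into U ` C" by blast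
    show "\<exists>k. \<forall>a\<in>A. \<exists>j<k. dist a (from_nat_into U j) < e"
    proof (rule exI[of _ "Suc (Max C)"], rule ballI)
      fix a assume "a \<in> A"
      then obtain y where "y \<in> N m" "dist y a < 1 / real (Suc m)" using N(3)[of m] by auto
      then obtain j where "j \<in> C" "dist (from_nat_into U j) a < 1 / real (Suc m)" using C by auto
      then show "\<exists>j<Suc (Max C). dist a (from_nat_into U j) < e"
        using C(1) m by (intro exI[of _ j]) (auto simp: dist_commute less_Suc_eq_le)
    qed
  qed
qed

text \<open>The labels name the cells of a countable measurable partition with \<open>R\<close>
  between any two points of a cell. In the applications \<open>R\<close> is closeness up to an error
  and need not be transitive; labels are combined by pairing, which gives the common
  refinement.\<close>

definition discretizable :: "'x measure \<Rightarrow> ('x \<Rightarrow> 'x \<Rightarrow> bool) \<Rightarrow> bool" where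
  "discretizable X R \<longleftrightarrow> (\<exists>l \<in> X \<rightarrow>\<^sub>M count_space (UNIV :: nat set).
     \<forall>x\<in>space X. \<forall>y\<in>space X. l x = l y \<longrightarrow> R x y)"

lemma measurable_prod_encode:
  assumes f: "f \<in> X \<rightarrow>\<^sub>M count_space UNIV" and g: "g \<in> X \<rightarrow>\<^sub>M count_space UNIV"
  shows "(\<lambda>x. prod_encode (f x, g x)) \<in> X \<rightarrow>\<^sub>M count_space UNIV"
proof -
  have "(\<lambda>x. prod_encode (i, g x)) \<in> X \<rightarrow>\<^sub>M count_space UNIV" for i
    by (rule measurable_compose[OF g]) simp
  from measurable_compose_countable[OF this f] show ?thesis .
qed

lemma discretizable_conj:
  assumes "discretizable X R" "discretizable X R'"
  shows "discretizable X (\<lambda>x y. R x y \<and> R' x y)"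
proof -
  obtain l l' where "l \<in> X \<rightarrow>\<^sub>M count_space (UNIV :: nat set)" "l' \<in> X \<rightarrow>\<^sub>M count_space (UNIV :: nat set)"
    and "\<forall>x\<in>space X. \<forall>y\<in>space X. l x = l y \<longrightarrow> R x y" "\<forall>x\<in>space X. \<forall>y\<in>space X. l' x = l' y \<longrightarrow> R' x y"
    using assms unfolding discretizable_def by blast
  then show ?thesis
    unfolding discretizable_def
    by (intro bexI[of _ "\<lambda>x. prod_encode (l x, l' x)"] measurable_prod_encode) (auto simp: prod_encode_eq)
qed

lemma discretizable_finite_conj:
  assumes "finite F" "\<And>f. f \<in> F \<Longrightarrow> discretizable X (R f)"
  shows "discretizable X (\<lambda>x y. \<forall>f\<in>F. R f x y)"
  using assms
proof (induction F)
  case empty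
  show ?case unfolding discretizable_def by (intro bexI[of _ "\<lambda>_. 0"]) auto
next
  case (insert f F)
  then show ?case using discretizable_conj[of X "R f" "\<lambda>x y. \<forall>f\<in>F. R f x y"] by simp
qed

lemma discretizable_mono:
  assumes "discretizable X R" "\<And>x y. x \<in> space X \<Longrightarrow> y \<in> space X \<Longrightarrow> R x y \<Longrightarrow> R' x y"
  shows "discretizable X R'"
  using assms unfolding discretizable_def by blast

lemma discretizable_real:
  fixes h :: "'x \<Rightarrow> real"
  assumes h: "h \<in> borel_measurable X" and "e > 0"
  shows "discretizable X (\<lambda>x y. \<bar>h x - h y\<bar> \<le> e)"
  unfolding discretizable_def
proof (intro bexI[of _ "\<lambda>x. to_nat \<lfloor>h x / e\<rfloor>"] ballI impI)
  have "(\<lambda>x. \<lfloor>h x / e\<rfloor>) \<in> X \<rightarrow>\<^sub>M count_space UNIV"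
    using h by measurable
  then show "(\<lambda>x. to_nat \<lfloor>h x / e\<rfloor>) \<in> X \<rightarrow>\<^sub>M count_space UNIV"
    by (rule measurable_compose) simp
  fix x y assume "to_nat \<lfloor>h x / e\<rfloor> = to_nat \<lfloor>h y / e\<rfloor>"
  then have "\<lfloor>h x / e\<rfloor> = \<lfloor>h y / e\<rfloor>" by simp
  then have "\<bar>h x / e - h y / e\<bar> \<le> 1" by linarith
  then have "\<bar>h x - h y\<bar> / e \<le> 1" using \<open>e > 0\<close> by (simp add: abs_divide flip: diff_divide_distrib)
  then show "\<bar>h x - h y\<bar> \<le> e" using \<open>e > 0\<close> by simp
qed

section \<open>How the data of the game vary with states and actions\<close>

locale stochastic_game =
  fixes X :: "'x measure"
    and A :: "'i::finite \<Rightarrow> 'a::metric_space set"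
    and p :: "'x \<times> ('i \<Rightarrow> 'a) \<Rightarrow> 'x measure"
    and c :: "'i \<Rightarrow> 'x \<times> ('i \<Rightarrow> 'a) \<Rightarrow> real"
    and b \<alpha> :: real
    and \<mu> :: "'x measure"
    and \<delta> :: "'x \<Rightarrow> 'x \<Rightarrow> ('i \<Rightarrow> 'a) \<Rightarrow> real"
  assumes state_space: "countably_generated X"
    and action_spaces: "\<And>i. compact (A i)" "\<And>i. A i \<noteq> {}"
    and cost_measurable: "\<And>i. c i \<in> borel_measurable (state_actions X A)"
    and b_pos: "b > 0"
    and cost_bounded: "\<And>i x a. x \<in> space X \<Longrightarrow> a \<in> (\<Pi>\<^sub>E i\<in>UNIV. A i) \<Longrightarrow> \<bar>c i (x, a)\<bar> \<le> b"
    and transition: "p \<in> state_actions X A \<rightarrow>\<^sub>M prob_algebra X"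
    and discount: "0 < \<alpha>" "\<alpha> < 1"
    and cost_continuous: "\<And>i x. x \<in> space X \<Longrightarrow> continuous_on (\<Pi>\<^sub>E i\<in>UNIV. A i) (\<lambda>a. c i (x, a))"
    and reference: "prob_space \<mu>" "sets \<mu> = sets X"
    and density_measurable: "(\<lambda>(x, y, a). \<delta> x y a) \<in> borel_measurable (X \<Otimes>\<^sub>M X \<Otimes>\<^sub>M joint_actions A)"
    and density_nonneg: "\<And>x y a. x \<in> space X \<Longrightarrow> y \<in> space X \<Longrightarrow> a \<in> (\<Pi>\<^sub>E i\<in>UNIV. A i) \<Longrightarrow> \<delta> x y a \<ge> 0"
    and density: "\<And>x a B. x \<in> space X \<Longrightarrow> a \<in> (\<Pi>\<^sub>E i\<in>UNIV. A i) \<Longrightarrow> B \<in> sets X \<Longrightarrow>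
      emeasure (p (x, a)) B = (\<integral>\<^sup>+y\<in>B. ennreal (\<delta> x y a) \<partial>\<mu>)"
    and density_continuous: "\<And>x s a. x \<in> space X \<Longrightarrow> (\<And>n::nat. s n \<in> (\<Pi>\<^sub>E i\<in>UNIV. A i)) \<Longrightarrow>
      a \<in> (\<Pi>\<^sub>E i\<in>UNIV. A i) \<Longrightarrow> s \<longlonglongrightarrow> a \<Longrightarrow>
      (\<lambda>n. \<integral>y. \<bar>\<delta> x y (s n) - \<delta> x y a\<bar> \<partial>\<mu>) \<longlonglongrightarrow> 0"
begin

sublocale ref: prob_space \<mu> by (rule reference)

abbreviation "\<A> \<equiv> (\<Pi>\<^sub>E i\<in>UNIV. A i)"

lemma space_joint_actions: "space (joint_actions A) = \<A>"
  by (simp add: joint_actions_def action_space_def space_PiM space_restrict_space)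

lemma space_state_actions: "space (state_actions X A) = space X \<times> \<A>"
  by (simp add: state_actions_def space_pair_measure space_joint_actions)

lemma space_reference: "space \<mu> = space X"
  using reference(2) by (rule sets_eq_imp_space_eq)

lemma density_section: "a \<in> \<A> \<Longrightarrow> (\<lambda>(x, y). \<delta> x y a) \<in> borel_measurable (X \<Otimes>\<^sub>M \<mu>)"
proof -
  assume a: "a \<in> \<A>"
  have "(\<lambda>z. (fst z, snd z, a)) \<in> X \<Otimes>\<^sub>M X \<rightarrow>\<^sub>M X \<Otimes>\<^sub>M X \<Otimes>\<^sub>M joint_actions A"
    using a by (intro measurable_Pair measurable_fst measurable_snd measurable_const) (simp add: space_joint_actions)
  from measurable_compose[OF this density_measurable]
  have "(\<lambda>(x, y). \<delta> x y a) \<in> borel_measurable (X \<Otimes>\<^sub>M X)"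
    by (simp add: case_prod_beta')
  then show ?thesis
    unfolding measurable_cong_sets[OF sets_pair_measure_cong[OF refl reference(2), of X] refl] .
qed

lemma density_measurable_section:
  assumes "x \<in> space X" "a \<in> \<A>"
  shows "(\<lambda>y. \<delta> x y a) \<in> borel_measurable \<mu>"
  using measurable_compose[OF measurable_Pair1'[OF assms(1)] density_section[OF assms(2)]] by simp

lemma p_eq_density:
  assumes "x \<in> space X" "a \<in> \<A>"
  shows "p (x, a) = density \<mu> (\<lambda>y. ennreal (\<delta> x y a))"
proof (rule measure_eqI)
  have xa: "(x, a) \<in> space (state_actions X A)" using assms by (simp add: space_state_actions)
  show "sets (p (x, a)) = sets (density \<mu> (\<lambda>y. ennreal (\<delta> x y a)))"
    using kernelD(2)[OF transition xa] reference(2) by simp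
  fix B assume "B \<in> sets (p (x, a))"
  then have B: "B \<in> sets X" "B \<in> sets \<mu>" using kernelD(2)[OF transition xa] reference(2) by auto
  show "emeasure (p (x, a)) B = emeasure (density \<mu> (\<lambda>y. ennreal (\<delta> x y a))) B"
    unfolding density[OF assms B(1)]
    by (rule emeasure_density[symmetric, OF measurable_compose[OF density_measurable_section[OF assms] measurable_ennreal] B(2)])
qed

lemma density_integrable:
  assumes "x \<in> space X" "a \<in> \<A>"
  shows "integrable \<mu> (\<lambda>y. \<delta> x y a)"
proof (rule integrableI_nonneg)
  have xa: "(x, a) \<in> space (state_actions X A)" using assms by (simp add: space_state_actions)
  interpret p: prob_space "p (x, a)" by (rule kernelD(1)[OF transition xa])
  have "(\<integral>\<^sup>+ y. ennreal (\<delta> x y a) \<partial>\<mu>) = (\<integral>\<^sup>+y\<in>space X. ennreal (\<delta> x y a) \<partial>\<mu>)"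
    by (rule nn_integral_cong) (simp add: space_reference)
  also have "\<dots> = emeasure (p (x, a)) (space X)"
    by (rule density[OF assms sets.top, symmetric])
  also have "\<dots> < \<infinity>"
    using p.emeasure_finite by (metis infinity_ennreal_def less_top)
  finally show "(\<integral>\<^sup>+ y. ennreal (\<delta> x y a) \<partial>\<mu>) < \<infinity>" .
  show "AE y in \<mu>. 0 \<le> \<delta> x y a"
    using density_nonneg assms by (auto simp: space_reference)
qed (rule density_measurable_section[OF assms])

lemma integral_transition:
  fixes V :: "'x \<Rightarrow> real"
  assumes "x \<in> space X" "a \<in> \<A>" "V \<in> borel_measurable X"
  shows "(\<integral>y. V y \<partial>p (x, a)) = (\<integral>y. \<delta> x y a * V y \<partial>\<mu>)"
proof -
  have "V \<in> borel_measurable \<mu>"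
    unfolding measurable_cong_sets[OF reference(2) refl] by (rule assms(3))
  then show ?thesis
    unfolding p_eq_density[OF assms(1,2)] using density_measurable_section[OF assms(1,2)] density_nonneg assms
    by (intro integral_real_density) (auto simp: space_reference)
qed

text \<open>A pseudometric on state-action pairs. Measuring the transition part by the
  \<open>L1\<close> distance of densities controls the continuation cost for all values bounded by
  \<open>b\<close> at once, before any value function is known; see
  \<open>utility_gap\<close>.\<close>

definition gap :: "'x \<Rightarrow> ('i \<Rightarrow> 'a) \<Rightarrow> 'x \<Rightarrow> ('i \<Rightarrow> 'a) \<Rightarrow> real" where
  "gap x a x' a' = (\<Sum>i\<in>UNIV. \<bar>c i (x, a) - c i (x', a')\<bar>) + (\<integral>y. \<bar>\<delta> x y a - \<delta> x' y a'\<bar> \<partial>\<mu>)"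

lemma gap_commute: "gap x a x' a' = gap x' a' x a"
  by (simp add: gap_def abs_minus_commute)

lemma gap_triangle:
  assumes "x \<in> space X" "a \<in> \<A>" "x' \<in> space X" "a' \<in> \<A>" "x'' \<in> space X" "a'' \<in> \<A>"
  shows "gap x a x'' a'' \<le> gap x a x' a' + gap x' a' x'' a''"
proof -
  have "(\<Sum>i\<in>UNIV. \<bar>c i (x, a) - c i (x'', a'')\<bar>) \<le> (\<Sum>i\<in>UNIV. \<bar>c i (x, a) - c i (x', a')\<bar> + \<bar>c i (x', a') - c i (x'', a'')\<bar>)"
    by (intro sum_mono) linarith
  then show ?thesis
    using L1_triangle[OF density_integrable[OF assms(1,2)] density_integrable[OF assms(3,4)] density_integrable[OF assms(5,6)]]
    by (simp add: gap_def sum.distrib)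
qed

lemma gap_tendsto:
  assumes x: "x \<in> space X" and s: "\<And>n::nat. s n \<in> \<A>" "a \<in> \<A>" and lim: "s \<longlonglongrightarrow> a"
  shows "(\<lambda>n. gap x (s n) x a) \<longlonglongrightarrow> 0"
proof -
  have "(\<lambda>n. \<bar>c i (x, s n) - c i (x, a)\<bar>) \<longlonglongrightarrow> 0" for i
  proof -
    have "(\<lambda>n. c i (x, s n)) \<longlonglongrightarrow> c i (x, a)"
      using continuous_on_tendsto_compose[OF cost_continuous[OF x] lim s(2)] s(1) by auto
    then have "(\<lambda>n. \<bar>c i (x, s n) - c i (x, a)\<bar>) \<longlonglongrightarrow> \<bar>c i (x, a) - c i (x, a)\<bar>"
      by (intro tendsto_intros)
    then show ?thesis by simp
  qed
  then have "(\<lambda>n. gap x (s n) x a) \<longlonglongrightarrow> (\<Sum>i\<in>(UNIV::'i set). 0) + 0"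
    unfolding gap_def by (intro tendsto_add tendsto_sum density_continuous[OF x s lim])
  then show ?thesis by simp
qed

text \<open>Uniform continuity on a compact set: from counterexamples for all \<open>m\<close> a
  subsequence converges, both action profiles have the same limit, and the gap to it tends to 0. The
  modulus depends on \<open>x\<close>.\<close>

lemma gap_modulus:
  assumes x: "x \<in> space X" and "e > 0"
  obtains m where "\<And>a a'. a \<in> \<A> \<Longrightarrow> a' \<in> \<A> \<Longrightarrow> (\<And>i. dist (a i) (a' i) < 1 / real (Suc m)) \<Longrightarrow> gap x a x a' \<le> e"
proof (rule ccontr)
  assume "\<not> thesis"
  then have "\<forall>m. \<exists>a a'. a \<in> \<A> \<and> a' \<in> \<A> \<and> (\<forall>i. dist (a i) (a' i) < 1 / real (Suc m)) \<and> \<not> gap x a x a' \<le> e"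
    using that by meson
  then obtain a a' where a: "\<And>m. a m \<in> \<A>" "\<And>m. a' m \<in> \<A>"
    and close: "\<And>m i. dist (a m i) (a' m i) < 1 / real (Suc m)"
    and far: "\<And>m. gap x (a m) x (a' m) > e"
    by (metis not_le)
  obtain l r where l: "l \<in> \<A>" and r: "strict_mono r" and lim: "(a \<circ> r) \<longlonglongrightarrow> l"
    by (rule seq_compactE[OF seq_compact_Pi_UNIV[of A], of a]) (use action_spaces a in auto)
  have lim_i: "(\<lambda>m. a (r m) i) \<longlonglongrightarrow> l i" for i
    using lim by (simp add: tendsto_fun_iff o_def)
  have "(\<lambda>m. a' (r m) i) \<longlonglongrightarrow> l i" for i
    unfolding tendsto_dist_iff[of "\<lambda>m. a' (r m) i"]
  proof (rule Lim_null_comparison)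
    show "\<forall>\<^sub>F m in sequentially. norm (dist (a' (r m) i) (l i)) \<le> 1 / real (Suc (r m)) + dist (a (r m) i) (l i)"
    proof (rule always_eventually, rule allI)
      fix m
      show "norm (dist (a' (r m) i) (l i)) \<le> 1 / real (Suc (r m)) + dist (a (r m) i) (l i)"
        using close[of "r m" i] dist_triangle2[of "a' (r m) i" "l i" "a (r m) i"]
        by (simp add: dist_commute)
    qed
    have "(\<lambda>m. 1 / real (Suc (r m))) \<longlonglongrightarrow> 0"
      using LIMSEQ_subseq_LIMSEQ[OF LIMSEQ_inverse_real_of_nat r] by (simp add: o_def inverse_eq_divide)
    from tendsto_add[OF this lim_i[of i, THEN iffD1[OF tendsto_dist_iff]]]
    show "(\<lambda>m. 1 / real (Suc (r m)) + dist (a (r m) i) (l i)) \<longlonglongrightarrow> 0" by simp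
  qed
  then have lim': "(\<lambda>m. a' (r m)) \<longlonglongrightarrow> l"
    by (simp add: tendsto_fun_iff)
  have "(\<lambda>m. gap x (a (r m)) x l + gap x (a' (r m)) x l) \<longlonglongrightarrow> 0 + 0"
    using lim lim' a l by (intro tendsto_add gap_tendsto[OF x]) (auto simp: o_def)
  then have "\<forall>\<^sub>F m in sequentially. gap x (a (r m)) x l + gap x (a' (r m)) x l < e"
    using \<open>e > 0\<close> by (intro order_tendstoD(2)) auto
  then obtain m where "gap x (a (r m)) x l + gap x (a' (r m)) x l < e"
    by (auto simp: eventually_sequentially)
  moreover have "gap x (a (r m)) x (a' (r m)) \<le> gap x (a (r m)) x l + gap x l x (a' (r m))"
    using x a l by (intro gap_triangle) auto
  ultimately show False using far[of "r m"] gap_commute[of x l x "a' (r m)"] by simp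
qed

lemma cost_section:
  assumes "a \<in> \<A>"
  shows "(\<lambda>x. c i (x, a)) \<in> borel_measurable X"
proof -
  have "(\<lambda>x. (x, a)) \<in> X \<rightarrow>\<^sub>M state_actions X A"
    unfolding state_actions_def using assms by (intro measurable_Pair) (auto simp: space_joint_actions)
  from measurable_compose[OF this cost_measurable] show ?thesis .
qed

lemma gap_measurable:
  assumes "a \<in> \<A>" "a' \<in> \<A>"
  shows "(\<lambda>x. gap x a x a') \<in> borel_measurable X"
proof -
  have "(\<lambda>z. \<bar>\<delta> (fst z) (snd z) a - \<delta> (fst z) (snd z) a'\<bar>) \<in> borel_measurable (X \<Otimes>\<^sub>M \<mu>)"
    using density_section[OF assms(1)] density_section[OF assms(2)]
    by (intro borel_measurable_abs borel_measurable_diff) (simp_all add: case_prod_beta')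
  then have m: "(\<lambda>x. \<integral>y. \<bar>\<delta> x y a - \<delta> x y a'\<bar> \<partial>\<mu>) \<in> borel_measurable X"
    by (intro ref.borel_measurable_lebesgue_integral) (simp add: case_prod_beta')
  show ?thesis
    unfolding gap_def
    by (intro borel_measurable_add borel_measurable_sum borel_measurable_abs borel_measurable_diff cost_section assms m)
qed

text \<open>A state is labelled by the first member of a countable dense family within
  \<open>e / 2\<close> of its density. Being the least index with a measurable property, the label
  is measurable.\<close>

lemma discretizable_density:
  assumes a: "a \<in> \<A>" and "e > 0"
  shows "discretizable X (\<lambda>x x'. (\<integral>y. \<bar>\<delta> x y a - \<delta> x' y a\<bar> \<partial>\<mu>) \<le> e)"
proof -
  obtain g :: "nat \<Rightarrow> 'x \<Rightarrow> real" where g: "\<forall>n. integrable \<mu> (g n)"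
    and dense: "\<forall>f. integrable \<mu> f \<longrightarrow> (\<forall>e>0. \<exists>n. (\<integral>x. \<bar>f x - g n x\<bar> \<partial>\<mu>) < e)"
    using ref.L1_separable[OF state_space reference(2)] by (elim exE conjE)
  define l where "l x = (LEAST n. (\<integral>y. \<bar>\<delta> x y a - g n y\<bar> \<partial>\<mu>) < e / 2)" for x
  have l: "(\<integral>y. \<bar>\<delta> x y a - g (l x) y\<bar> \<partial>\<mu>) < e / 2" if "x \<in> space X" for x
    unfolding l_def by (rule LeastI_ex) (use dense density_integrable[OF that a] half_gt_zero[OF \<open>e > 0\<close>] in blast)
  show ?thesis
    unfolding discretizable_def
  proof (intro bexI[of _ l] ballI impI)
    have [measurable]: "(\<lambda>x. \<integral>y. \<bar>\<delta> x y a - g n y\<bar> \<partial>\<mu>) \<in> borel_measurable X" for n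
    proof -
      have "(\<lambda>z. \<bar>\<delta> (fst z) (snd z) a - g n (snd z)\<bar>) \<in> borel_measurable (X \<Otimes>\<^sub>M \<mu>)"
        using density_section[OF a] measurable_compose[OF measurable_snd borel_measurable_integrable[OF g[rule_format]]]
        by (intro borel_measurable_abs borel_measurable_diff) (simp_all add: case_prod_beta')
      then show ?thesis
        by (intro ref.borel_measurable_lebesgue_integral) (simp add: case_prod_beta')
    qed
    show "l \<in> X \<rightarrow>\<^sub>M count_space UNIV"
      unfolding l_def by measurable
    fix x x' assume xx': "x \<in> space X" "x' \<in> space X" "l x = l x'"
    have "(\<integral>y. \<bar>\<delta> x y a - \<delta> x' y a\<bar> \<partial>\<mu>) \<le> (\<integral>y. \<bar>\<delta> x y a - g (l x) y\<bar> \<partial>\<mu>) + (\<integral>y. \<bar>g (l x) y - \<delta> x' y a\<bar> \<partial>\<mu>)"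
      by (intro L1_triangle density_integrable xx' a g[rule_format])
    also have "\<dots> \<le> e / 2 + e / 2"
      using l[OF xx'(1)] l[OF xx'(2)] xx'(3) by (intro add_mono) (simp_all add: abs_minus_commute)
    finally show "(\<integral>y. \<bar>\<delta> x y a - \<delta> x' y a\<bar> \<partial>\<mu>) \<le> e" by simp
  qed
qed

lemma discretizable_gap:
  assumes a: "a \<in> \<A>" and "e > 0"
  shows "discretizable X (\<lambda>x x'. gap x a x' a \<le> e)"
proof -
  define n where "n = real (card (UNIV :: 'i set))"
  have "n > 0" unfolding n_def by (simp add: card_gt_0_iff)
  have "discretizable X (\<lambda>x x'. \<forall>i\<in>UNIV. \<bar>c i (x, a) - c i (x', a)\<bar> \<le> e / 2 / n)"
    using \<open>n > 0\<close> \<open>e > 0\<close> by (intro discretizable_finite_conj discretizable_real cost_section a) auto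
  moreover have "discretizable X (\<lambda>x x'. (\<integral>y. \<bar>\<delta> x y a - \<delta> x' y a\<bar> \<partial>\<mu>) \<le> e / 2)"
    using \<open>e > 0\<close> by (intro discretizable_density a) simp
  ultimately show ?thesis
  proof (rule discretizable_mono[OF discretizable_conj])
    fix x x'
    assume close: "(\<forall>i\<in>UNIV. \<bar>c i (x, a) - c i (x', a)\<bar> \<le> e / 2 / n) \<and> (\<integral>y. \<bar>\<delta> x y a - \<delta> x' y a\<bar> \<partial>\<mu>) \<le> e / 2"
    have "(\<Sum>i\<in>UNIV. \<bar>c i (x, a) - c i (x', a)\<bar>) \<le> (\<Sum>i\<in>(UNIV::'i set). e / 2 / n)"
      by (rule sum_mono) (use close in blast)
    also have "\<dots> = e / 2"
      using \<open>n > 0\<close> by (simp add: n_def)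
    finally have "gap x a x' a \<le> e / 2 + e / 2"
      unfolding gap_def by (rule add_mono) (rule conjunct2[OF close])
    then show "gap x a x' a \<le> e" by simp
  qed
qed

end

section \<open>Finitely supported mixed actions\<close>

text \<open>Fubini's theorem with coordinate \<open>i\<close> in the outer integral; it separates
  one player's mixed action from those of the others.\<close>

lemma
  fixes f :: "('i \<Rightarrow> 'b) \<Rightarrow> real"
  assumes M: "\<And>j. j \<in> insert i I \<Longrightarrow> prob_space (M j)"
    and f: "f \<in> borel_measurable (PiM (insert i I) M)" "\<And>a. a \<in> space (PiM (insert i I) M) \<Longrightarrow> \<bar>f a\<bar> \<le> B"
  shows integral_PiM_insert: "(\<integral>a. f a \<partial>PiM (insert i I) M) = (\<integral>y. \<integral>a. f (a(i := y)) \<partial>PiM I M \<partial>M i)"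
    and integrable_PiM_section: "integrable (M i) (\<lambda>y. \<integral>a. f (a(i := y)) \<partial>PiM I M)"
proof -
  interpret Mi: prob_space "M i" using M by auto
  interpret P: prob_space "PiM I M" using M by (intro prob_space_PiM) auto
  interpret PP: pair_prob_space "M i" "PiM I M" ..
  have upd: "(\<lambda>(y, a). a(i := y)) \<in> M i \<Otimes>\<^sub>M PiM I M \<rightarrow>\<^sub>M PiM (insert i I) M"
    unfolding case_prod_beta' by (rule measurable_fun_upd[where J = I]) auto
  have g: "(\<lambda>z. f (case z of (y, a) \<Rightarrow> a(i := y))) \<in> borel_measurable (M i \<Otimes>\<^sub>M PiM I M)"
    using measurable_compose[OF upd f(1)] .
  have int: "integrable (M i \<Otimes>\<^sub>M PiM I M) (\<lambda>z. f (case z of (y, a) \<Rightarrow> a(i := y)))"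
    by (rule PP.P.integrable_const_bound[of _ B, OF _ g])
      (use f(2) measurable_space[OF upd] in \<open>auto intro!: AE_I2\<close>)
  have "(\<integral>a. f a \<partial>PiM (insert i I) M) = (\<integral>a. f a \<partial>distr (M i \<Otimes>\<^sub>M PiM I M) (PiM (insert i I) M) (\<lambda>(y, a). a(i := y)))"
    by (subst distr_pair_PiM_eq_PiM) (use M in auto)
  also have "\<dots> = (\<integral>z. f (case z of (y, a) \<Rightarrow> a(i := y)) \<partial>(M i \<Otimes>\<^sub>M PiM I M))"
    by (rule integral_distr[OF upd f(1)])
  also have "\<dots> = (\<integral>y. \<integral>a. f (a(i := y)) \<partial>PiM I M \<partial>M i)"
    using PP.integral_fst'[OF int] by simp
  finally show "(\<integral>a. f a \<partial>PiM (insert i I) M) = (\<integral>y. \<integral>a. f (a(i := y)) \<partial>PiM I M \<partial>M i)" .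
  show "integrable (M i) (\<lambda>y. \<integral>a. f (a(i := y)) \<partial>PiM I M)"
    using PP.integrable_fst'[OF int] by simp
qed

text \<open>The weights sit on indices and not on points, since \<open>d\<close> may repeat
  values.\<close>

definition finite_mixture :: "'b measure \<Rightarrow> (nat \<Rightarrow> 'b) \<Rightarrow> nat \<Rightarrow> (nat \<Rightarrow> real) \<Rightarrow> 'b measure" where
  "finite_mixture N d k q = distr (point_measure {..<k} (\<lambda>j. ennreal (q j))) N d"

definition weights :: "nat \<Rightarrow> (nat \<Rightarrow> real) \<Rightarrow> bool" where
  "weights k q \<longleftrightarrow> (\<forall>j. 0 \<le> q j) \<and> (\<Sum>j<k. q j) = 1"

lemma sets_finite_mixture [simp, measurable_cong]: "sets (finite_mixture N d k q) = sets N"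
  by (simp add: finite_mixture_def)

lemma space_finite_mixture [simp]: "space (finite_mixture N d k q) = space N"
  by (simp add: finite_mixture_def)

lemma measurable_atoms:
  "(\<And>j. d j \<in> space N) \<Longrightarrow> d \<in> point_measure {..<k::nat} q \<rightarrow>\<^sub>M N"
  by (auto simp: measurable_def space_point_measure sets_point_measure)

lemma prob_space_finite_mixture:
  assumes "\<And>j. d j \<in> space N" "weights k q"
  shows "prob_space (finite_mixture N d k q)"
  unfolding finite_mixture_def
proof (rule prob_space.prob_space_distr[OF _ measurable_atoms[OF assms(1)]])
  have "(\<Sum>j<k. ennreal (q j)) = 1"
    using assms(2) by (simp add: weights_def sum_ennreal)
  then show "prob_space (point_measure {..<k} (\<lambda>j. ennreal (q j)))"
    by (intro prob_spaceI) (simp add: space_point_measure emeasure_point_measure_finite)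
qed

lemma integral_finite_mixture:
  fixes f :: "'b \<Rightarrow> real"
  assumes "\<And>j. d j \<in> space N" "weights k q" "f \<in> borel_measurable N"
  shows "(\<integral>y. f y \<partial>finite_mixture N d k q) = (\<Sum>j<k. q j * f (d j))"
  unfolding finite_mixture_def
  using assms(2) by (subst integral_distr[OF measurable_atoms[OF assms(1)] assms(3)])
    (simp add: lebesgue_integral_point_measure_finite weights_def)

lemma AE_finite_mixture:
  assumes "\<And>j. d j \<in> space N" "\<And>j. {d j} \<in> sets N"
  shows "AE y in finite_mixture N d k q. y \<in> d ` {..<k}"
proof -
  have "d ` {..<k} = (\<Union>j\<in>{..<k}. {d j})" by auto
  also have "\<dots> \<in> sets N" using assms(2) by (intro sets.finite_UN) auto
  finally have S: "{y \<in> space N. y \<in> d ` {..<k}} \<in> sets N"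
    using sets.sets_into_space by (simp add: Collect_conj_eq Int_absorb1)
  show ?thesis
    unfolding finite_mixture_def
    by (subst AE_distr_iff[OF measurable_atoms[OF assms(1)] S]) (auto simp: space_point_measure intro!: AE_I2)
qed

lemma measurable_PiM_finite_mixture:
  "f \<in> PiM I N \<rightarrow>\<^sub>M L \<Longrightarrow> f \<in> PiM I (\<lambda>i. finite_mixture (N i) (d i) (k i) (q i)) \<rightarrow>\<^sub>M L"
  by (subst measurable_cong_sets[OF sets_PiM_cong[OF refl sets_finite_mixture] refl])

lemma space_PiM_finite_mixture:
  "space (PiM I (\<lambda>i. finite_mixture (N i) (d i) (k i) (q i))) = space (PiM I N)"
  by (simp add: space_PiM)

text \<open>Splitting off one player turns the integral into a finite sum, in which the weights
  converge by assumption and the inner integrals by induction. Integrand and measure vary together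
  with \<open>m\<close>, so dominated convergence for a fixed measure does not apply.\<close>

lemma tendsto_integral_PiM_finite_mixture:
  fixes u :: "nat \<Rightarrow> ('i \<Rightarrow> 'b) \<Rightarrow> real"
  assumes "finite I"
    and d: "\<And>i j. d i j \<in> space (N i)"
    and q: "\<And>m i. weights (k i) (q m i)" "\<And>i. weights (k i) (q' i)" "\<And>i j. (\<lambda>m. q m i j) \<longlonglongrightarrow> q' i j"
    and u: "\<And>m. u m \<in> borel_measurable (PiM I N)" "\<And>m a. a \<in> space (PiM I N) \<Longrightarrow> \<bar>u m a\<bar> \<le> B"
    and u': "u' \<in> borel_measurable (PiM I N)"
    and lim: "\<And>a. a \<in> space (PiM I N) \<Longrightarrow> (\<lambda>m. u m a) \<longlonglongrightarrow> u' a"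
  shows "(\<lambda>m. \<integral>a. u m a \<partial>PiM I (\<lambda>i. finite_mixture (N i) (d i) (k i) (q m i))) \<longlonglongrightarrow>
    (\<integral>a. u' a \<partial>PiM I (\<lambda>i. finite_mixture (N i) (d i) (k i) (q' i)))"
  using \<open>finite I\<close> u u' lim
proof (induction I arbitrary: u u')
  case empty
  have "(\<lambda>m. u m (\<lambda>_. undefined)) \<longlonglongrightarrow> u' (\<lambda>_. undefined)"
    by (rule empty(4)) simp
  then show ?case
    by (simp add: PiM_empty lebesgue_integral_count_space_finite)
next
  case (insert i I)
  define P where "P q = PiM I (\<lambda>i. finite_mixture (N i) (d i) (k i) (q i))" for q
  \<comment> \<open>The bound is inherited in the limit, so that the splitting below also applies to
    \<open>u'\<close>.\<close>
  have u'_bound: "\<bar>u' a\<bar> \<le> B" if "a \<in> space (PiM (insert i I) N)" for a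
    using insert.prems(4)[OF that] insert.prems(2)[OF that]
    by (intro LIMSEQ_le_const2[OF tendsto_rabs]) auto
  have split: "(\<integral>a. w a \<partial>PiM (insert i I) (\<lambda>i. finite_mixture (N i) (d i) (k i) (r i)))
      = (\<Sum>j<k i. r i j * (\<integral>a. w (a(i := d i j)) \<partial>P r))"
    if r: "\<And>i. weights (k i) (r i)" and w: "w \<in> borel_measurable (PiM (insert i I) N)"
      "\<And>a. a \<in> space (PiM (insert i I) N) \<Longrightarrow> \<bar>w a\<bar> \<le> B" for w :: "('i \<Rightarrow> 'b) \<Rightarrow> real" and r
  proof -
    note ps = prob_space_finite_mixture[OF d r]
    have "(\<integral>a. w a \<partial>PiM (insert i I) (\<lambda>i. finite_mixture (N i) (d i) (k i) (r i)))
        = (\<integral>y. \<integral>a. w (a(i := y)) \<partial>P r \<partial>finite_mixture (N i) (d i) (k i) (r i))"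
      unfolding P_def
      by (rule integral_PiM_insert[where B = B, OF ps measurable_PiM_finite_mixture[OF w(1)]])
        (use w(2) in \<open>simp add: space_PiM_finite_mixture\<close>)
    also have "\<dots> = (\<Sum>j<k i. r i j * (\<integral>a. w (a(i := d i j)) \<partial>P r))"
    proof (rule integral_finite_mixture[OF d r])
      have "integrable (finite_mixture (N i) (d i) (k i) (r i)) (\<lambda>y. \<integral>a. w (a(i := y)) \<partial>P r)"
        unfolding P_def
        by (rule integrable_PiM_section[where B = B, OF ps measurable_PiM_finite_mixture[OF w(1)]])
          (use w(2) in \<open>simp add: space_PiM_finite_mixture\<close>)
      then show "(\<lambda>y. \<integral>a. w (a(i := y)) \<partial>P r) \<in> borel_measurable (N i)"
        using borel_measurable_integrable measurable_cong_sets[OF sets_finite_mixture refl] by blast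
    qed
    finally show ?thesis .
  qed
  have upd: "(\<lambda>a. a(i := d i j)) \<in> PiM I N \<rightarrow>\<^sub>M PiM (insert i I) N" for j
    by (rule measurable_fun_upd[where J = I]) (auto simp: d)
  have "(\<lambda>m. \<integral>a. u m (a(i := d i j)) \<partial>P (q m)) \<longlonglongrightarrow> (\<integral>a. u' (a(i := d i j)) \<partial>P q')" for j
    unfolding P_def
    by (rule insert.IH; (rule measurable_compose[OF upd] insert.prems)?; (rule measurable_space[OF upd] insert.prems)?; assumption?)
  then have "(\<lambda>m. \<Sum>j<k i. q m i j * (\<integral>a. u m (a(i := d i j)) \<partial>P (q m))) \<longlonglongrightarrow>
      (\<Sum>j<k i. q' i j * (\<integral>a. u' (a(i := d i j)) \<partial>P q'))"
    by (intro tendsto_sum tendsto_mult q(3))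
  moreover have "(\<integral>a. u m a \<partial>PiM (insert i I) (\<lambda>i. finite_mixture (N i) (d i) (k i) (q m i)))
      = (\<Sum>j<k i. q m i j * (\<integral>a. u m (a(i := d i j)) \<partial>P (q m)))" for m
    by (rule split[OF q(1) insert.prems(1,2)])
  moreover have "(\<integral>a. u' a \<partial>PiM (insert i I) (\<lambda>i. finite_mixture (N i) (d i) (k i) (q' i)))
      = (\<Sum>j<k i. q' i j * (\<integral>a. u' (a(i := d i j)) \<partial>P q'))"
    by (rule split[OF q(2) insert.prems(3) u'_bound])
  ultimately show ?case by (simp only:)
qed

section \<open>Construction of the types\<close>

context stochastic_game
begin

text \<open>The modulus of continuity varies with the state, so the number of listed actions is not
  uniform and becomes part of the type. In the last gap condition the order of quantifiers matters:
  the substitute \<open>j\<close> for \<open>a\<close> serves against all choices \<open>f\<close>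
  of the others, hence also under an integral over their mixed actions.\<close>

lemma discretization:
  assumes "e > 0"
  obtains d :: "'i \<Rightarrow> nat \<Rightarrow> 'a" and T :: "'x \<Rightarrow> nat" and K :: "nat \<Rightarrow> nat" and r :: "nat \<Rightarrow> 'x"
  where "\<And>i j. d i j \<in> A i"
    and "T \<in> X \<rightarrow>\<^sub>M count_space UNIV"
    and "\<And>s. r s \<in> space X"
    and "\<And>x f. x \<in> space X \<Longrightarrow> (\<And>i. f i < K (T x)) \<Longrightarrow>
      gap x (\<lambda>i. d i (f i)) (r (T x)) (\<lambda>i. d i (f i)) \<le> e"
    and "\<And>x i a. x \<in> space X \<Longrightarrow> a \<in> A i \<Longrightarrow> \<exists>j<K (T x). \<forall>f.
      gap x ((\<lambda>i. d i (f i))(i := a)) x ((\<lambda>i. d i (f i))(i := d i j)) \<le> e"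
    and "\<And>s. K s > 0"
proof -
  have "\<forall>i. \<exists>d :: nat \<Rightarrow> 'a. (\<forall>j. d j \<in> A i) \<and> (\<forall>e>0. \<exists>k. \<forall>a\<in>A i. \<exists>j<k. dist a (d j) < e)"
    using compact_dense_sequence[OF action_spaces] by metis
  from choice[OF this] obtain d :: "'i \<Rightarrow> nat \<Rightarrow> 'a"
    where d: "\<And>i j. d i j \<in> A i" and net: "\<And>i e. e > 0 \<Longrightarrow> \<exists>k. \<forall>a\<in>A i. \<exists>j<k. dist a (d i j) < e"
    by blast
  define D where "D f = (\<lambda>i. d i (f i))" for f
  have D: "D f \<in> \<A>" for f using d by (simp add: D_def PiE_UNIV_domain Pi_iff)
  have "\<forall>m. \<exists>k. \<forall>i. \<forall>a\<in>A i. \<exists>j<k. dist a (d i j) < 1 / real (Suc m)"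
  proof
    fix m
    have "\<forall>i. \<exists>k. \<forall>a\<in>A i. \<exists>j<k. dist a (d i j) < 1 / real (Suc m)"
      using net by simp
    from choice[OF this] obtain k where k: "\<And>i. \<forall>a\<in>A i. \<exists>j<k i. dist a (d i j) < 1 / real (Suc m)"
      by blast
    \<comment> \<open>The sum serves as a bound common to all of the finitely many players.\<close>
    have le: "k i \<le> (\<Sum>i\<in>UNIV. k i)" for i by (rule member_le_sum) auto
    show "\<exists>k. \<forall>i. \<forall>a\<in>A i. \<exists>j<k. dist a (d i j) < 1 / real (Suc m)"
      using k le by (meson less_le_trans)
  qed
  from choice[OF this] obtain kk where kk: "\<And>m i. \<forall>a\<in>A i. \<exists>j<kk m. dist a (d i j) < 1 / real (Suc m)"
    by blast
  \<comment> \<open>Uniform continuity is demanded for listed actions only. Index profiles are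
    countably many, so this is a countable conjunction of measurable conditions and \<open>M\<close>
    is measurable.\<close>
  define good where "good m x \<longleftrightarrow>
    (\<forall>f f'. (\<forall>i. dist (d i (f i)) (d i (f' i)) < 1 / real (Suc m)) \<longrightarrow> gap x (D f) x (D f') \<le> e)" for m x
  define M where "M x = (LEAST m. good m x)" for x
  have goodM: "good (M x) x" if x: "x \<in> space X" for x
    unfolding M_def
  proof (rule LeastI_ex)
    obtain m where "\<And>a a'. a \<in> \<A> \<Longrightarrow> a' \<in> \<A> \<Longrightarrow> (\<And>i. dist (a i) (a' i) < 1 / real (Suc m)) \<Longrightarrow> gap x a x a' \<le> e"
      by (rule gap_modulus[OF x \<open>e > 0\<close>]) blast
    from this[OF D D] show "\<exists>m. good m x" unfolding good_def D_def by blast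
  qed
  have [measurable]: "Measurable.pred X (good m)" for m
  proof -
    have [measurable]: "(\<lambda>x. gap x (D f) x (D f')) \<in> borel_measurable X" for f f'
      by (rule gap_measurable[OF D D])
    show ?thesis unfolding good_def by measurable
  qed
  have M: "M \<in> X \<rightarrow>\<^sub>M count_space UNIV"
    unfolding M_def by measurable
  have "\<exists>l \<in> X \<rightarrow>\<^sub>M count_space (UNIV :: nat set). \<forall>x\<in>space X. \<forall>y\<in>space X. l x = l y \<longrightarrow>
      (\<forall>f\<in>PiE UNIV (\<lambda>_. {..<k}). gap x (D f) y (D f) \<le> e)" for k
    unfolding discretizable_def[symmetric]
    by (intro discretizable_finite_conj discretizable_gap D \<open>e > 0\<close> finite_PiE) auto
  then have "\<forall>k. \<exists>l. l \<in> X \<rightarrow>\<^sub>M count_space (UNIV :: nat set) \<and> (\<forall>x\<in>space X. \<forall>y\<in>space X. l x = l y \<longrightarrow>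
      (\<forall>f\<in>PiE UNIV (\<lambda>_. {..<k}). gap x (D f) y (D f) \<le> e))"
    by blast
  from choice[OF this] obtain l where l: "\<And>k. l k \<in> X \<rightarrow>\<^sub>M count_space (UNIV :: nat set)"
    and l_gap: "\<And>k. \<forall>x\<in>space X. \<forall>y\<in>space X. l k x = l k y \<longrightarrow>
      (\<forall>f\<in>PiE UNIV (\<lambda>_. {..<k}). gap x (D f) y (D f) \<le> e)"
    by blast
  \<comment> \<open>The first component fixes how many actions are in use; the second is the label
    that compares states on the finitely many profiles of these actions. Both can be decoded from
    the type, which gives \<open>K\<close>.\<close>
  define T where "T x = prod_encode (M x, l (kk (M x)) x)" for x
  define K where "K s = kk (fst (prod_decode s))" for s
  have KT: "K (T x) = kk (M x)" for x by (simp add: K_def T_def)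
  have "(\<lambda>x. prod_encode (m, l (kk m) x)) \<in> X \<rightarrow>\<^sub>M count_space UNIV" for m
    by (rule measurable_compose[OF l]) simp
  from measurable_compose_countable[OF this M] have T: "T \<in> X \<rightarrow>\<^sub>M count_space UNIV"
    unfolding T_def .
  obtain x\<^sub>0 where x\<^sub>0: "x\<^sub>0 \<in> space X" using ref.not_empty by (auto simp: space_reference)
  \<comment> \<open>The default \<open>x\<^sub>0\<close> keeps \<open>r s\<close> a state for
    numbers \<open>s\<close> that are no state's type.\<close>
  define r where "r s = (if \<exists>x\<in>space X. T x = s then SOME x. x \<in> space X \<and> T x = s else x\<^sub>0)" for s
  have r_T: "r (T x) \<in> space X" "T (r (T x)) = T x" if "x \<in> space X" for x
  proof -
    have "\<exists>y. y \<in> space X \<and> T y = T x" using that by blast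
    from someI_ex[OF this] show "r (T x) \<in> space X" "T (r (T x)) = T x"
      using that unfolding r_def by auto
  qed
  show ?thesis
  proof (rule that[of d T r K])
    show "d i j \<in> A i" for i j by (rule d)
    show "T \<in> X \<rightarrow>\<^sub>M count_space UNIV" by (rule T)
    show "r s \<in> space X" for s
    proof (cases "\<exists>x\<in>space X. T x = s")
      case True
      then show ?thesis using r_T(1) by blast
    next
      case False
      then show ?thesis using x\<^sub>0 by (simp add: r_def)
    qed
    show "K s > 0" for s
    proof -
      obtain i :: 'i and a where "a \<in> A i" using action_spaces(2) by blast
      with kk[of i "fst (prod_decode s)"] show ?thesis unfolding K_def by fastforce
    qed
    show "gap x (\<lambda>i. d i (f i)) (r (T x)) (\<lambda>i. d i (f i)) \<le> e"
      if x: "x \<in> space X" and f: "\<And>i. f i < K (T x)" for x f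
    proof -
      have eq: "M (r (T x)) = M x" "l (kk (M x)) x = l (kk (M x)) (r (T x))"
        using r_T(2)[OF x] by (auto simp: T_def prod_encode_eq)
      have "f \<in> PiE UNIV (\<lambda>_. {..<kk (M x)})" using f by (simp add: KT PiE_UNIV_domain)
      then show ?thesis
        using l_gap[of "kk (M x)"] x r_T(1)[OF x] eq(2) unfolding D_def by blast
    qed
    show "\<exists>j<K (T x). \<forall>f. gap x ((\<lambda>i. d i (f i))(i := a)) x ((\<lambda>i. d i (f i))(i := d i j)) \<le> e"
      if x: "x \<in> space X" and a: "a \<in> A i" for x i a
    proof -
      obtain j where j: "j < kk (M x)" "dist a (d i j) < 1 / real (Suc (M x))" using kk a by blast
      \<comment> \<open>As \<open>good\<close> knows only listed actions, \<open>a\<close> is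
        reached as a limit of listed actions \<open>\<rho> n\<close>; once these are close to
        \<open>d i j\<close>, the bound \<open>e\<close> holds and survives the limit.\<close>
      have "\<forall>n. \<exists>j'. dist a (d i j') < 1 / real (Suc n)" using kk a by blast
      from choice[OF this] obtain \<rho> where \<rho>: "\<And>n. dist a (d i (\<rho> n)) < 1 / real (Suc n)" by blast
      have lim: "(\<lambda>n. d i (\<rho> n)) \<longlonglongrightarrow> a"
        unfolding tendsto_dist_iff[of "\<lambda>n. d i (\<rho> n)"]
      proof (rule Lim_null_comparison)
        show "\<forall>\<^sub>F n in sequentially. norm (dist (d i (\<rho> n)) a) \<le> inverse (real (Suc n))"
          using \<rho> by (intro always_eventually allI) (simp add: dist_commute less_imp_le inverse_eq_divide)
        show "(\<lambda>n. inverse (real (Suc n))) \<longlonglongrightarrow> 0" by (rule LIMSEQ_inverse_real_of_nat)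
      qed
      have "gap x ((\<lambda>i. d i (f i))(i := a)) x ((\<lambda>i. d i (f i))(i := d i j)) \<le> e" for f
      proof -
        have upd: "(\<lambda>i. d i (f i))(i := d i j') = D (f(i := j'))" for j' by (auto simp: D_def)
        have fa: "(\<lambda>i. d i (f i))(i := a) \<in> \<A>" using d a by (simp add: PiE_UNIV_domain Pi_iff)
        have lim': "(\<lambda>n. D (f(i := \<rho> n))) \<longlonglongrightarrow> (\<lambda>i. d i (f i))(i := a)"
          unfolding tendsto_fun_iff upd[symmetric] using lim by auto
        have g0: "(\<lambda>n. gap x (D (f(i := \<rho> n))) x ((\<lambda>i. d i (f i))(i := a))) \<longlonglongrightarrow> 0"
          by (rule gap_tendsto[OF x D fa lim'])
        have "\<forall>\<^sub>F n in sequentially. dist (d i (\<rho> n)) (d i j) < 1 / real (Suc (M x))"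
          using order_tendstoD(2)[OF tendsto_dist[OF lim tendsto_const] j(2)] .
        then have "\<forall>\<^sub>F n in sequentially. gap x ((\<lambda>i. d i (f i))(i := a)) x (D (f(i := j)))
            \<le> gap x (D (f(i := \<rho> n))) x ((\<lambda>i. d i (f i))(i := a)) + e"
        proof (rule eventually_mono)
          fix n assume "dist (d i (\<rho> n)) (d i j) < 1 / real (Suc (M x))"
          then have "\<forall>i'. dist (d i' ((f(i := \<rho> n)) i')) (d i' ((f(i := j)) i')) < 1 / real (Suc (M x))"
            by simp
          then have "gap x (D (f(i := \<rho> n))) x (D (f(i := j))) \<le> e"
            using goodM[OF x] unfolding good_def by blast
          moreover have "gap x ((\<lambda>i. d i (f i))(i := a)) x (D (f(i := j)))
              \<le> gap x ((\<lambda>i. d i (f i))(i := a)) x (D (f(i := \<rho> n))) + gap x (D (f(i := \<rho> n))) x (D (f(i := j)))"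
            by (rule gap_triangle[OF x fa x D x D])
          ultimately show "gap x ((\<lambda>i. d i (f i))(i := a)) x (D (f(i := j)))
            \<le> gap x (D (f(i := \<rho> n))) x ((\<lambda>i. d i (f i))(i := a)) + e"
            by (simp add: gap_commute[of x "(\<lambda>i. d i (f i))(i := a)"])
        qed
        from tendsto_lowerbound[OF tendsto_add[OF g0 tendsto_const] this]
        show ?thesis by (simp add: upd)
      qed
      then show ?thesis using j(1) unfolding KT by blast
    qed
  qed
qed

end

section \<open>One-shot approximate equilibria\<close>

context stochastic_game
begin

definition utility :: "'i \<Rightarrow> ('x \<Rightarrow> real) \<Rightarrow> 'x \<Rightarrow> ('i \<Rightarrow> 'a) \<Rightarrow> real" where
  "utility i V x a = (1 - \<alpha>) * c i (x, a) + \<alpha> * (\<integral>y. V y \<partial>p (x, a))"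

lemma measurable_utility:
  assumes "x \<in> space X" "V \<in> borel_measurable X"
  shows "utility i V x \<in> borel_measurable (joint_actions A)"
proof -
  have x: "Pair x \<in> joint_actions A \<rightarrow>\<^sub>M state_actions X A"
    unfolding state_actions_def by (rule measurable_Pair1'[OF assms(1)])
  show ?thesis
    unfolding utility_def
    using measurable_compose[OF x cost_measurable[of i]]
      measurable_compose[OF x measurable_integral_kernel[OF transition assms(2)]]
    by measurable
qed

lemma utility_bounded:
  assumes "x \<in> space X" "a \<in> \<A>" and V: "V \<in> borel_measurable X" "\<And>y. y \<in> space X \<Longrightarrow> \<bar>V y\<bar> \<le> b"
  shows "\<bar>utility i V x a\<bar> \<le> b"
proof -
  have xa: "(x, a) \<in> space (state_actions X A)" using assms by (simp add: space_state_actions)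
  have "\<bar>\<integral>y. V y \<partial>p (x, a)\<bar> \<le> b"
    by (rule abs_integral_le_const[OF kernelD(1)[OF transition xa]])
      (simp_all add: V measurable_cong_sets[OF kernelD(2)[OF transition xa] refl] kernelD(3)[OF transition xa])
  then have "(1 - \<alpha>) * \<bar>c i (x, a)\<bar> + \<alpha> * \<bar>\<integral>y. V y \<partial>p (x, a)\<bar> \<le> (1 - \<alpha>) * b + \<alpha> * b"
    using discount cost_bounded[OF assms(1,2)] by (intro add_mono mult_left_mono) auto
  moreover have "\<bar>utility i V x a\<bar> \<le> (1 - \<alpha>) * \<bar>c i (x, a)\<bar> + \<alpha> * \<bar>\<integral>y. V y \<partial>p (x, a)\<bar>"
    unfolding utility_def using discount by (intro order.trans[OF abs_triangle_ineq]) (simp add: abs_mult)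
  ultimately show ?thesis by (simp add: algebra_simps)
qed

text \<open>The continuation costs differ by at most \<open>b\<close> times the \<open>L1\<close>
  distance of the densities. With \<open>1 - \<alpha>\<close> and \<open>\<alpha>\<close> estimated
  by 1, the factor \<open>1 + b\<close> covers both parts.\<close>

lemma utility_gap:
  assumes x: "x \<in> space X" "a \<in> \<A>" and x': "x' \<in> space X" "a' \<in> \<A>"
    and V: "V \<in> borel_measurable X" "\<And>y. y \<in> space X \<Longrightarrow> \<bar>V y\<bar> \<le> b"
  shows "\<bar>utility i V x a - utility i V x' a'\<bar> \<le> (1 + b) * gap x a x' a'"
proof -
  define I where "I = (\<integral>y. \<bar>\<delta> x y a - \<delta> x' y a'\<bar> \<partial>\<mu>)"
  define C where "C = (\<Sum>i\<in>UNIV. \<bar>c i (x, a) - c i (x', a')\<bar>)"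
  have "I \<ge> 0" "C \<ge> 0" by (simp_all add: I_def C_def sum_nonneg)
  have c: "\<bar>c i (x, a) - c i (x', a')\<bar> \<le> C"
    unfolding C_def by (rule member_le_sum) auto
  have Vm: "V \<in> borel_measurable \<mu>"
    unfolding measurable_cong_sets[OF reference(2) refl] by (rule V(1))
  have Vi: "integrable \<mu> (\<lambda>y. \<delta> z y a * V y)" if z: "z \<in> space X" "a \<in> \<A>" for z a
  proof (rule Bochner_Integration.integrable_bound)
    show "integrable \<mu> (\<lambda>y. b * \<delta> z y a)" using density_integrable[OF z] by simp
    show "(\<lambda>y. \<delta> z y a * V y) \<in> borel_measurable \<mu>"
      using density_measurable_section[OF z] Vm by simp
    show "AE y in \<mu>. norm (\<delta> z y a * V y) \<le> norm (b * \<delta> z y a)"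
    proof (rule AE_I2)
      fix y assume "y \<in> space \<mu>"
      then have "\<bar>V y\<bar> \<le> \<bar>b\<bar>" using V(2) b_pos by (simp add: space_reference)
      from mult_left_mono[OF this, of "\<bar>\<delta> z y a\<bar>"]
      show "norm (\<delta> z y a * V y) \<le> norm (b * \<delta> z y a)" by (simp add: abs_mult mult.commute)
    qed
  qed
  have "\<bar>(\<integral>y. V y \<partial>p (x, a)) - (\<integral>y. V y \<partial>p (x', a'))\<bar> = \<bar>\<integral>y. (\<delta> x y a - \<delta> x' y a') * V y \<partial>\<mu>\<bar>"
    using Vi[OF x] Vi[OF x'] by (simp add: integral_transition x x' V(1) left_diff_distrib)
  also have "\<dots> \<le> (\<integral>y. \<bar>\<delta> x y a - \<delta> x' y a'\<bar> * b \<partial>\<mu>)"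
  proof (rule order.trans[OF integral_abs_bound], rule integral_mono)
    show "integrable \<mu> (\<lambda>y. \<bar>(\<delta> x y a - \<delta> x' y a') * V y\<bar>)"
      using Vi[OF x] Vi[OF x'] by (simp add: left_diff_distrib)
    show "integrable \<mu> (\<lambda>y. \<bar>\<delta> x y a - \<delta> x' y a'\<bar> * b)"
      using density_integrable[OF x] density_integrable[OF x'] by simp
    fix y assume "y \<in> space \<mu>"
    then have "\<bar>V y\<bar> \<le> b" using V(2) by (simp add: space_reference)
    then show "\<bar>(\<delta> x y a - \<delta> x' y a') * V y\<bar> \<le> \<bar>\<delta> x y a - \<delta> x' y a'\<bar> * b"
      unfolding abs_mult by (rule mult_left_mono) simp
  qed
  also have "\<dots> = I * b" by (simp add: I_def)
  finally have t: "\<bar>(\<integral>y. V y \<partial>p (x, a)) - (\<integral>y. V y \<partial>p (x', a'))\<bar> \<le> I * b" .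
  have "\<bar>utility i V x a - utility i V x' a'\<bar> = \<bar>(1 - \<alpha>) * (c i (x, a) - c i (x', a')) + \<alpha> * ((\<integral>y. V y \<partial>p (x, a)) - (\<integral>y. V y \<partial>p (x', a')))\<bar>"
    by (simp add: utility_def algebra_simps)
  also have "\<dots> \<le> (1 - \<alpha>) * \<bar>c i (x, a) - c i (x', a')\<bar> + \<alpha> * \<bar>(\<integral>y. V y \<partial>p (x, a)) - (\<integral>y. V y \<partial>p (x', a'))\<bar>"
    using discount by (intro order.trans[OF abs_triangle_ineq]) (simp add: abs_mult)
  also have "\<dots> \<le> 1 * C + 1 * (I * b)"
    using discount c t by (intro add_mono mult_mono) auto
  also have "\<dots> \<le> (1 + b) * (C + I)"
    using b_pos \<open>C \<ge> 0\<close> \<open>I \<ge> 0\<close> by (simp add: algebra_simps)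
  finally show ?thesis by (simp add: gap_def C_def I_def)
qed

end

section \<open>Nearly best replies and prospective costs over the types\<close>

locale discretized_game = stochastic_game X A p c b \<alpha> \<mu> \<delta>
  for X :: "'x measure" and A :: "'i::finite \<Rightarrow> 'a::metric_space set" and p c b \<alpha> \<mu> \<delta> +
  fixes d :: "'i \<Rightarrow> nat \<Rightarrow> 'a" and T :: "'x \<Rightarrow> nat" and K :: "nat \<Rightarrow> nat" and r :: "nat \<Rightarrow> 'x" and e :: real
  assumes atoms: "\<And>i j. d i j \<in> A i"
    and measurable_type: "T \<in> X \<rightarrow>\<^sub>M count_space UNIV"
    and rep: "\<And>s. r s \<in> space X"
    and gap_type: "\<And>x f. x \<in> space X \<Longrightarrow> (\<And>i. f i < K (T x)) \<Longrightarrow>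
      gap x (\<lambda>i. d i (f i)) (r (T x)) (\<lambda>i. d i (f i)) \<le> e"
    and gap_action: "\<And>x i a. x \<in> space X \<Longrightarrow> a \<in> A i \<Longrightarrow> \<exists>j<K (T x). \<forall>f.
      gap x ((\<lambda>i. d i (f i))(i := a)) x ((\<lambda>i. d i (f i))(i := d i j)) \<le> e"
    and K_pos: "\<And>s. K s > 0"
    and e_pos: "e > 0"
begin

text \<open>A vector \<open>Q\<close> assigns to player \<open>i\<close>, type \<open>s\<close> and action number \<open>j\<close> a prospective cost.
  The weights below depend continuously on \<open>Q\<close> and charge only actions whose cost is within \<open>e\<close>
  of the minimum, so that no convexity of best replies is needed.\<close>

definition raw :: "('i \<times> nat \<times> nat \<Rightarrow> real) \<Rightarrow> 'i \<Rightarrow> nat \<Rightarrow> nat \<Rightarrow> real" where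
  "raw Q i s j = (\<Prod>k<K s. max 0 (e - (Q (i, s, j) - Q (i, s, k))))"

definition wt :: "('i \<times> nat \<times> nat \<Rightarrow> real) \<Rightarrow> 'i \<Rightarrow> nat \<Rightarrow> nat \<Rightarrow> real" where
  "wt Q i s j = raw Q i s j / (\<Sum>j<K s. raw Q i s j)"

definition val :: "('i \<times> nat \<times> nat \<Rightarrow> real) \<Rightarrow> 'i \<Rightarrow> nat \<Rightarrow> real" where
  "val Q i s = (\<Sum>j<K s. wt Q i s j * Q (i, s, j))"

definition mixed :: "('i \<times> nat \<times> nat \<Rightarrow> real) \<Rightarrow> nat \<Rightarrow> 'i \<Rightarrow> 'a measure" where
  "mixed Q s i = finite_mixture (action_space A i) (d i) (K s) (wt Q i s)"

text \<open>The new cost of action \<open>j\<close> for type \<open>s\<close> is computed at the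
  representative \<open>r s\<close>: player \<open>i\<close> plays \<open>d i j\<close>, the others
  mix according to \<open>Q\<close>, and the continuation is the value of the type of the next state
  under the original transition law.\<close>

definition update :: "('i \<times> nat \<times> nat \<Rightarrow> real) \<Rightarrow> 'i \<times> nat \<times> nat \<Rightarrow> real" where
  "update Q = (\<lambda>(i, s, j). \<integral>a. utility i (\<lambda>y. val Q i (T y)) (r s) (a(i := d i j)) \<partial>PiM (- {i}) (mixed Q s))"

lemma raw_nonneg: "raw Q i s j \<ge> 0"
  unfolding raw_def by (intro prod_nonneg) auto

text \<open>For a cheapest action each factor is at least \<open>e\<close>. So the normalization in
  \<open>wt\<close> never divides by 0, which makes the weights continuous in
  \<open>Q\<close>.\<close>

lemma sum_raw_pos: "(\<Sum>j<K s. raw Q i s j) > 0"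
proof -
  obtain j where j: "j < K s" "\<And>k. k < K s \<Longrightarrow> Q (i, s, j) \<le> Q (i, s, k)"
    using ex_is_arg_min_if_finite[of "{..<K s}" "\<lambda>j. Q (i, s, j)"] K_pos[of s]
    by (auto simp: is_arg_min_linorder)
  have "raw Q i s j > 0"
    unfolding raw_def
  proof (intro prod_pos ballI)
    fix k assume "k \<in> {..<K s}"
    then have "Q (i, s, j) \<le> Q (i, s, k)" using j(2) by simp
    then show "0 < max 0 (e - (Q (i, s, j) - Q (i, s, k)))" using e_pos by (simp add: less_max_iff_disj)
  qed
  then show ?thesis
    using raw_nonneg j(1) by (intro sum_pos2[of _ j]) auto
qed

lemma weights_wt: "weights (K s) (wt Q i s)"
  unfolding weights_def wt_def using sum_raw_pos[of Q i s] raw_nonneg[of Q i s]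
  by (auto simp: divide_nonneg_pos simp flip: sum_divide_distrib)

text \<open>An action of positive weight has no vanishing factor; its factor for \<open>k\<close>
  then says that it costs less than \<open>e\<close> more than \<open>k\<close>. Averaging over the
  weights keeps the bound.\<close>

lemma val_le_add:
  assumes "k < K s"
  shows "val Q i s \<le> Q (i, s, k) + e"
proof -
  have "wt Q i s j * Q (i, s, j) \<le> wt Q i s j * (Q (i, s, k) + e)" for j
  proof (cases "raw Q i s j = 0")
    case False
    then have "max 0 (e - (Q (i, s, j) - Q (i, s, k))) \<noteq> 0"
      unfolding raw_def using assms by auto
    then have "Q (i, s, j) \<le> Q (i, s, k) + e" by (auto simp: max_def split: if_splits)
    then show ?thesis using weights_wt[of s Q i] by (intro mult_left_mono) (auto simp: weights_def)
  qed (simp add: wt_def)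
  then have "val Q i s \<le> (\<Sum>j<K s. wt Q i s j * (Q (i, s, k) + e))"
    unfolding val_def by (intro sum_mono)
  also have "\<dots> = Q (i, s, k) + e"
    using weights_wt[of s Q i] by (simp add: weights_def flip: sum_distrib_right)
  finally show ?thesis .
qed

lemma val_bounded:
  assumes "\<And>k. \<bar>Q k\<bar> \<le> b"
  shows "\<bar>val Q i s\<bar> \<le> b"
proof -
  have "\<bar>val Q i s\<bar> \<le> (\<Sum>j<K s. \<bar>wt Q i s j * Q (i, s, j)\<bar>)"
    unfolding val_def by (rule sum_abs)
  also have "\<dots> \<le> (\<Sum>j<K s. wt Q i s j * b)"
    using weights_wt[of s Q i] assms by (intro sum_mono) (auto simp: weights_def abs_mult intro!: mult_left_mono)
  also have "\<dots> = b"
    using weights_wt[of s Q i] by (simp add: weights_def flip: sum_distrib_right)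
  finally show ?thesis .
qed

lemma atoms_space: "d i j \<in> space (action_space A i)"
  by (simp add: action_space_def space_restrict_space atoms)

lemma prob_space_mixed: "prob_space (mixed Q s i)"
  unfolding mixed_def by (intro prob_space_finite_mixture atoms_space weights_wt)

lemma sets_mixed: "sets (mixed Q s i) = sets (action_space A i)"
  by (simp add: mixed_def)

lemma measurable_value: "(\<lambda>y. val Q i (T y)) \<in> borel_measurable X"
  by (rule measurable_compose[OF measurable_type]) simp

lemma measurable_deviate:
  assumes "a' \<in> A i"
  shows "(\<lambda>a. a(i := a')) \<in> PiM (- {i}) (action_space A) \<rightarrow>\<^sub>M joint_actions A"
  unfolding joint_actions_def
  by (rule measurable_fun_upd[where J = "- {i}"])
    (use assms in \<open>auto simp: action_space_def space_restrict_space\<close>)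

lemma measurable_utility_deviate:
  assumes "x \<in> space X" "a' \<in> A i"
  shows "(\<lambda>a. utility i (\<lambda>y. val Q l (T y)) x (a(i := a'))) \<in> borel_measurable (PiM (- {i}) (action_space A))"
  by (rule measurable_compose[OF measurable_deviate[OF assms(2)] measurable_utility[OF assms(1) measurable_value]])

lemma utility_deviate_bounded:
  assumes "x \<in> space X" "a' \<in> A i" "a \<in> space (PiM (- {i}) (action_space A))" "\<And>k. \<bar>Q k\<bar> \<le> b"
  shows "\<bar>utility i (\<lambda>y. val Q l (T y)) x (a(i := a'))\<bar> \<le> b"
  using measurable_space[OF measurable_deviate[OF assms(2)] assms(3)]
  by (intro utility_bounded assms(1) measurable_value val_bounded assms(4)) (simp add: space_joint_actions)

lemma update_bounded:
  assumes Q: "\<And>k. \<bar>Q k\<bar> \<le> b"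
  shows "\<bar>update Q k\<bar> \<le> b"
proof -
  obtain i s j where k: "k = (i, s, j)" by (cases k) auto
  have sets: "sets (PiM (- {i}) (mixed Q s)) = sets (PiM (- {i}) (action_space A))"
    by (rule sets_PiM_cong[OF refl sets_mixed])
  have "\<bar>\<integral>a. utility i (\<lambda>y. val Q i (T y)) (r s) (a(i := d i j)) \<partial>PiM (- {i}) (mixed Q s)\<bar> \<le> b"
  proof (rule abs_integral_le_const)
    show "prob_space (PiM (- {i}) (mixed Q s))" by (intro prob_space_PiM prob_space_mixed)
    show "(\<lambda>a. utility i (\<lambda>y. val Q i (T y)) (r s) (a(i := d i j))) \<in> borel_measurable (PiM (- {i}) (mixed Q s))"
      unfolding measurable_cong_sets[OF sets refl] by (rule measurable_utility_deviate[OF rep atoms])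
    show "\<bar>utility i (\<lambda>y. val Q i (T y)) (r s) (a(i := d i j))\<bar> \<le> b" if "a \<in> space (PiM (- {i}) (mixed Q s))" for a
      using that unfolding sets_eq_imp_space_eq[OF sets] by (intro utility_deviate_bounded rep atoms Q)
  qed
  then show ?thesis by (simp add: update_def k)
qed

section \<open>Continuity of the update and its fixed point\<close>

lemma tendsto_wt:
  assumes "\<And>k. (\<lambda>m. Q m k) \<longlonglongrightarrow> Q' k"
  shows "(\<lambda>m. wt (Q m) i s j) \<longlonglongrightarrow> wt Q' i s j"
proof -
  have "(\<lambda>m. raw (Q m) i s j) \<longlonglongrightarrow> raw Q' i s j" for j
    unfolding raw_def by (intro tendsto_prod tendsto_max tendsto_intros assms)
  then show ?thesis
    unfolding wt_def using sum_raw_pos[of Q' i s] by (intro tendsto_divide tendsto_sum) auto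
qed

lemma tendsto_val:
  assumes "\<And>k. (\<lambda>m. Q m k) \<longlonglongrightarrow> Q' k"
  shows "(\<lambda>m. val (Q m) i s) \<longlonglongrightarrow> val Q' i s"
  unfolding val_def by (intro tendsto_sum tendsto_mult tendsto_wt assms)

text \<open>Coordinatewise convergence of \<open>Q\<close> gives convergence of the values at every
  state, and the constant \<open>b\<close> dominates them. Here the product topology on cost vectors
  proves strong enough.\<close>

lemma tendsto_utility:
  assumes Q: "\<And>m k. \<bar>Q m k\<bar> \<le> b" and lim: "\<And>k. (\<lambda>m. Q m k) \<longlonglongrightarrow> Q' k"
    and x: "x \<in> space X" "a \<in> \<A>"
  shows "(\<lambda>m. utility i (\<lambda>y. val (Q m) i (T y)) x a) \<longlonglongrightarrow> utility i (\<lambda>y. val Q' i (T y)) x a"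
proof -
  have xa: "(x, a) \<in> space (state_actions X A)" using x by (simp add: space_state_actions)
  interpret p: prob_space "p (x, a)" by (rule kernelD(1)[OF transition xa])
  have m: "(\<lambda>y. val Q i (T y)) \<in> borel_measurable (p (x, a))" for Q
    unfolding measurable_cong_sets[OF kernelD(2)[OF transition xa] refl] by (rule measurable_value)
  have "(\<lambda>m. \<integral>y. val (Q m) i (T y) \<partial>p (x, a)) \<longlonglongrightarrow> (\<integral>y. val Q' i (T y) \<partial>p (x, a))"
    by (rule integral_dominated_convergence[where w = "\<lambda>_. b"])
      (use val_bounded[OF Q] m in \<open>auto intro!: AE_I2 tendsto_val lim\<close>)
  then show ?thesis unfolding utility_def by (intro tendsto_intros)
qed

lemma tendsto_update:
  assumes Q: "\<And>m k. \<bar>Q m k\<bar> \<le> b" and lim: "\<And>k. (\<lambda>m. Q m k) \<longlonglongrightarrow> Q' k"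
  shows "(\<lambda>m. update (Q m) k) \<longlonglongrightarrow> update Q' k"
proof -
  obtain i s j where k: "k = (i, s, j)" by (cases k) auto
  have "(\<lambda>m. \<integral>a. utility i (\<lambda>y. val (Q m) i (T y)) (r s) (a(i := d i j)) \<partial>PiM (- {i}) (mixed (Q m) s))
    \<longlonglongrightarrow> (\<integral>a. utility i (\<lambda>y. val Q' i (T y)) (r s) (a(i := d i j)) \<partial>PiM (- {i}) (mixed Q' s))"
    unfolding mixed_def
  proof (rule tendsto_integral_PiM_finite_mixture)
    show "weights (K s) (wt (Q m) i s)" "weights (K s) (wt Q' i s)" for m i
      by (rule weights_wt)+
    show "(\<lambda>m. wt (Q m) i s j) \<longlonglongrightarrow> wt Q' i s j" for i j
      by (rule tendsto_wt[OF lim])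
    show "(\<lambda>a. utility i (\<lambda>y. val Q i (T y)) (r s) (a(i := d i j))) \<in> borel_measurable (PiM (- {i}) (action_space A))" for Q
      by (rule measurable_utility_deviate[OF rep atoms])
    then show "(\<lambda>a. utility i (\<lambda>y. val Q' i (T y)) (r s) (a(i := d i j))) \<in> borel_measurable (PiM (- {i}) (action_space A))" .
    fix a assume a: "a \<in> space (PiM (- {i}) (action_space A))"
    show "\<bar>utility i (\<lambda>y. val (Q m) i (T y)) (r s) (a(i := d i j))\<bar> \<le> b" for m
      by (rule utility_deviate_bounded[OF rep atoms a Q])
    show "(\<lambda>m. utility i (\<lambda>y. val (Q m) i (T y)) (r s) (a(i := d i j))) \<longlonglongrightarrow>
        utility i (\<lambda>y. val Q' i (T y)) (r s) (a(i := d i j))"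
      using measurable_space[OF measurable_deviate[OF atoms] a]
      by (intro tendsto_utility Q lim rep) (simp add: space_joint_actions)
  qed (simp_all add: atoms_space)
  then show ?thesis by (simp add: update_def k)
qed

lemma fixed_point:
  obtains Q where "\<And>k. \<bar>Q k\<bar> \<le> b" "update Q = Q"
proof -
  obtain Q where "\<And>k. Q k \<in> {- b..b}" "update Q = Q"
  proof (rule countable_box_fixed_point[of "- b" b update])
    show "- b < b" using b_pos by simp
    show "update Q k \<in> {- b..b}" if "\<And>k. Q k \<in> {- b..b}" for Q k
    proof -
      have "\<bar>update Q k\<bar> \<le> b" by (rule update_bounded) (use that in \<open>simp add: abs_le_iff minus_le_iff\<close>)
      then show ?thesis by (simp add: abs_le_iff minus_le_iff)
    qed
    show "(\<lambda>m. update (Q m) k) \<longlonglongrightarrow> update Q' k"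
      if "\<And>m k. Q m k \<in> {- b..b}" "\<And>k. (\<lambda>m. Q m k) \<longlonglongrightarrow> Q' k" for Q Q' k
      by (rule tendsto_update[OF _ that(2)]) (use that(1) in \<open>simp add: abs_le_iff minus_le_iff\<close>)
  qed blast
  then show ?thesis by (intro that[of Q]) (auto simp: abs_le_iff minus_le_iff)
qed

section \<open>One-shot inequalities at a fixed point\<close>

lemma AE_atoms: "AE a in PiM (- {i}) (mixed Q s). \<exists>f. (\<forall>l. f l < K s) \<and> (\<forall>l. l \<noteq> i \<longrightarrow> a l = d l (f l))"
proof -
  have "AE a in PiM (- {i}) (mixed Q s). a l \<in> d l ` {..<K s}" if "l \<noteq> i" for l
  proof (rule AE_PiM_component)
    show "AE y in mixed Q s l. y \<in> d l ` {..<K s}"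
      unfolding mixed_def
    proof (rule AE_finite_mixture[OF atoms_space])
      fix j
      have "{d l j} = A l \<inter> {d l j}" using atoms[of l j] by auto
      then show "{d l j} \<in> sets (action_space A l)"
        unfolding action_space_def sets_restrict_space by (intro image_eqI[of _ _ "{d l j}"]) auto
    qed
  qed (use that in \<open>auto intro: prob_space_mixed\<close>)
  then have "AE a in PiM (- {i}) (mixed Q s). \<forall>l. l \<noteq> i \<longrightarrow> a l \<in> d l ` {..<K s}"
    by (subst AE_all_countable) auto
  then show ?thesis
  proof (rule AE_mp, intro AE_I2 impI)
    fix a assume "\<forall>l. l \<noteq> i \<longrightarrow> a l \<in> d l ` {..<K s}"
    \<comment> \<open>Nothing constrains the index at \<open>l = i\<close>, which is not a
      coordinate of the integral; \<open>K_pos\<close> supplies some admissible value there.\<close>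
    then have "\<forall>l. \<exists>j. j < K s \<and> (l \<noteq> i \<longrightarrow> a l = d l j)" using K_pos[of s] by fastforce
    from choice[OF this] show "\<exists>f. (\<forall>l. f l < K s) \<and> (\<forall>l. l \<noteq> i \<longrightarrow> a l = d l (f l))" by blast
  qed
qed

text \<open>The opponents' mixed actions live on atoms, where states of one type have nearly equal data.\<close>

lemma integral_deviation_diff:
  assumes Q: "\<And>k. \<bar>Q k\<bar> \<le> b" and x: "x \<in> space X" "a\<^sub>1 \<in> A i" and x': "x' \<in> space X" "a\<^sub>2 \<in> A i"
    and gap: "\<And>f. (\<And>l. f l < K s) \<Longrightarrow> gap x ((\<lambda>l. d l (f l))(i := a\<^sub>1)) x' ((\<lambda>l. d l (f l))(i := a\<^sub>2)) \<le> e"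
  shows "\<bar>(\<integral>a. utility i (\<lambda>y. val Q i (T y)) x (a(i := a\<^sub>1)) \<partial>PiM (- {i}) (mixed Q s)) -
    (\<integral>a. utility i (\<lambda>y. val Q i (T y)) x' (a(i := a\<^sub>2)) \<partial>PiM (- {i}) (mixed Q s))\<bar> \<le> (1 + b) * e"
proof -
  let ?P = "PiM (- {i}) (mixed Q s)" and ?u = "utility i (\<lambda>y. val Q i (T y))"
  interpret P: prob_space ?P by (intro prob_space_PiM prob_space_mixed)
  have sets: "sets ?P = sets (PiM (- {i}) (action_space A))"
    by (rule sets_PiM_cong[OF refl sets_mixed])
  have int: "integrable ?P (\<lambda>a. ?u z (a(i := a')))" if z: "z \<in> space X" "a' \<in> A i" for z a'
  proof (rule P.integrable_const_bound[of _ b])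
    show "(\<lambda>a. ?u z (a(i := a'))) \<in> borel_measurable ?P"
      unfolding measurable_cong_sets[OF sets refl] by (rule measurable_utility_deviate[OF z])
    show "AE a in ?P. norm (?u z (a(i := a'))) \<le> b"
      unfolding real_norm_def
      by (intro AE_I2 utility_deviate_bounded z Q) (simp add: sets_eq_imp_space_eq[OF sets])
  qed
  have close: "AE a in ?P. \<bar>?u x (a(i := a\<^sub>1)) - ?u x' (a(i := a\<^sub>2))\<bar> \<le> (1 + b) * e"
    using AE_atoms
  proof (rule AE_mp, intro AE_I2 impI)
    fix a assume "\<exists>f. (\<forall>l. f l < K s) \<and> (\<forall>l. l \<noteq> i \<longrightarrow> a l = d l (f l))"
    then obtain f where f: "\<And>l. f l < K s" "\<And>l. l \<noteq> i \<Longrightarrow> a l = d l (f l)" by blast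
    have upd: "a(i := a') = (\<lambda>l. d l (f l))(i := a')" for a' using f(2) by auto
    have mem: "(\<lambda>l. d l (f l))(i := a') \<in> \<A>" if "a' \<in> A i" for a'
      using that atoms by (simp add: PiE_UNIV_domain Pi_iff)
    have "\<bar>?u x (a(i := a\<^sub>1)) - ?u x' (a(i := a\<^sub>2))\<bar> \<le> (1 + b) * gap x ((\<lambda>l. d l (f l))(i := a\<^sub>1)) x' ((\<lambda>l. d l (f l))(i := a\<^sub>2))"
      unfolding upd by (intro utility_gap x x' mem measurable_value val_bounded Q)
    also have "\<dots> \<le> (1 + b) * e"
      using gap[OF f(1)] b_pos by (intro mult_left_mono) auto
    finally show "\<bar>?u x (a(i := a\<^sub>1)) - ?u x' (a(i := a\<^sub>2))\<bar> \<le> (1 + b) * e" .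
  qed
  have "\<bar>\<integral>a. ?u x (a(i := a\<^sub>1)) - ?u x' (a(i := a\<^sub>2)) \<partial>?P\<bar> \<le> (\<integral>a. \<bar>?u x (a(i := a\<^sub>1)) - ?u x' (a(i := a\<^sub>2))\<bar> \<partial>?P)"
    by (rule integral_abs_bound)
  also have "\<dots> \<le> (1 + b) * e"
    using int[OF x] int[OF x'] by (intro P.integral_le_const close) auto
  finally show ?thesis using int[OF x] int[OF x'] by simp
qed

lemma gap_type_update:
  assumes "x \<in> space X" "j < K (T x)" "\<And>l. f l < K (T x)"
  shows "gap x ((\<lambda>l. d l (f l))(i := d i j)) (r (T x)) ((\<lambda>l. d l (f l))(i := d i j)) \<le> e"
proof -
  have eq: "(\<lambda>l. d l (f l))(i := d i j) = (\<lambda>l. d l ((f(i := j)) l))" by auto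
  show ?thesis unfolding eq by (rule gap_type) (use assms in auto)
qed

text \<open>Three errors add up: \<open>a'\<close> is replaced by a listed action, \<open>y\<close>
  by its representative, each at cost \<open>(1 + b) * e\<close>, and the value exceeds the cost of
  any listed action by at most \<open>e\<close>. At the fixed point the cost of action
  \<open>j\<close> at the representative is exactly \<open>Q (i, T y, j)\<close>.\<close>

lemma deviation_cost_ge:
  assumes Q: "\<And>k. \<bar>Q k\<bar> \<le> b" "update Q = Q" and y: "y \<in> space X" and a': "a' \<in> A i"
  shows "val Q i (T y) - (3 + 2 * b) * e \<le>
    (\<integral>a. utility i (\<lambda>y. val Q i (T y)) y (a(i := a')) \<partial>PiM (- {i}) (mixed Q (T y)))"
proof -
  obtain j where j: "j < K (T y)"
    and gap: "\<And>f. gap y ((\<lambda>l. d l (f l))(i := a')) y ((\<lambda>l. d l (f l))(i := d i j)) \<le> e"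
    using gap_action[OF y a'] by blast
  define G where "G z a' = (\<integral>a. utility i (\<lambda>y. val Q i (T y)) z (a(i := a')) \<partial>PiM (- {i}) (mixed Q (T y)))" for z a'
  have "\<bar>G y a' - G y (d i j)\<bar> \<le> (1 + b) * e"
    unfolding G_def by (rule integral_deviation_diff[OF Q(1) y a' y atoms gap])
  moreover have "\<bar>G y (d i j) - G (r (T y)) (d i j)\<bar> \<le> (1 + b) * e"
    unfolding G_def by (rule integral_deviation_diff[OF Q(1) y atoms rep atoms gap_type_update[OF y j]])
  moreover have "G (r (T y)) (d i j) = Q (i, T y, j)"
    using fun_cong[OF Q(2), of "(i, T y, j)"] by (simp add: update_def G_def)
  moreover have "val Q i (T y) \<le> Q (i, T y, j) + e"
    by (rule val_le_add[OF j])
  moreover have "(3 + 2 * b) * e = 2 * ((1 + b) * e) + e" by (simp add: algebra_simps)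
  ultimately show ?thesis unfolding G_def by linarith
qed

text \<open>Isolates player \<open>i\<close>, who uses an arbitrary mixed action
  \<open>\<sigma>\<close>; it serves the deviations and, with \<open>\<sigma>\<close> taken from
  \<open>mixed\<close>, the equilibrium play itself.\<close>

lemma joint_cost_split:
  fixes s :: nat
  assumes Q: "\<And>k. \<bar>Q k\<bar> \<le> b" and y: "y \<in> space X"
    and \<sigma>: "prob_space \<sigma>" "sets \<sigma> = sets (action_space A i)"
  defines "G \<equiv> \<lambda>a'. \<integral>a. utility i (\<lambda>y. val Q i (T y)) y (a(i := a')) \<partial>PiM (- {i}) (mixed Q s)"
  shows "(\<integral>a. utility i (\<lambda>y. val Q i (T y)) y a \<partial>PiM UNIV ((mixed Q s)(i := \<sigma>))) = (\<integral>a'. G a' \<partial>\<sigma>)"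
    and "integrable \<sigma> G"
proof -
  let ?M = "(mixed Q s)(i := \<sigma>)"
  have UN: "insert i (- {i}) = UNIV" by auto
  have sets: "sets (PiM UNIV ?M) = sets (joint_actions A)"
    unfolding joint_actions_def by (rule sets_PiM_cong) (auto simp: sets_mixed \<sigma>(2))
  have eq: "PiM (- {i}) ?M = PiM (- {i}) (mixed Q s)"
    by (rule PiM_cong) auto
  have M: "prob_space (?M l)" for l using prob_space_mixed \<sigma>(1) by simp
  have u: "utility i (\<lambda>y. val Q i (T y)) y \<in> borel_measurable (PiM UNIV ?M)"
    unfolding measurable_cong_sets[OF sets refl] by (rule measurable_utility[OF y measurable_value])
  have ub: "\<bar>utility i (\<lambda>y. val Q i (T y)) y a\<bar> \<le> b" if "a \<in> space (PiM UNIV ?M)" for a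
    using that unfolding sets_eq_imp_space_eq[OF sets] space_joint_actions
    by (intro utility_bounded y measurable_value val_bounded Q)
  from integral_PiM_insert[where I = "- {i}" and i = i and M = ?M, unfolded UN, OF M u ub]
  show "(\<integral>a. utility i (\<lambda>y. val Q i (T y)) y a \<partial>PiM UNIV ?M) = (\<integral>a'. G a' \<partial>\<sigma>)"
    by (simp add: eq G_def)
  from integrable_PiM_section[where I = "- {i}" and i = i and M = ?M, unfolded UN, OF M u ub]
  show "integrable \<sigma> G"
    by (simp add: eq G_def)
qed

text \<open>Own play uses listed actions only, so just the passage to the representative costs
  something. Averaging \<open>Q\<close> with the own weights gives \<open>val\<close> by
  definition.\<close>

lemma equilibrium_cost_le:
  assumes Q: "\<And>k. \<bar>Q k\<bar> \<le> b" "update Q = Q" and y: "y \<in> space X"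
  shows "(\<integral>a. utility i (\<lambda>y. val Q i (T y)) y a \<partial>PiM UNIV (mixed Q (T y))) \<le> val Q i (T y) + (1 + b) * e"
proof -
  define G where "G z a' = (\<integral>a. utility i (\<lambda>y. val Q i (T y)) z (a(i := a')) \<partial>PiM (- {i}) (mixed Q (T y)))" for z a'
  have w: "weights (K (T y)) (wt Q i (T y))" by (rule weights_wt)
  note split = joint_cost_split[where s = "T y" and Q = Q, OF Q(1) y prob_space_mixed[of Q "T y" i] sets_mixed, folded G_def]
  have "G y \<in> borel_measurable (action_space A i)"
    using borel_measurable_integrable[OF split(2)] unfolding measurable_cong_sets[OF sets_mixed refl] .
  then have "(\<integral>a'. G y a' \<partial>mixed Q (T y) i) = (\<Sum>j<K (T y). wt Q i (T y) j * G y (d i j))"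
    unfolding mixed_def[of Q "T y" i] by (rule integral_finite_mixture[OF atoms_space w])
  also have "\<dots> \<le> (\<Sum>j<K (T y). wt Q i (T y) j * (Q (i, T y, j) + (1 + b) * e))"
  proof (intro sum_mono mult_left_mono)
    fix j assume "j \<in> {..<K (T y)}"
    then have j: "j < K (T y)" by simp
    have "\<bar>G y (d i j) - G (r (T y)) (d i j)\<bar> \<le> (1 + b) * e"
      unfolding G_def by (rule integral_deviation_diff[OF Q(1) y atoms rep atoms gap_type_update[OF y j]])
    moreover have "G (r (T y)) (d i j) = Q (i, T y, j)"
      using fun_cong[OF Q(2), of "(i, T y, j)"] by (simp add: update_def G_def)
    ultimately show "G y (d i j) \<le> Q (i, T y, j) + (1 + b) * e" by linarith
    show "0 \<le> wt Q i (T y) j" using w by (simp add: weights_def)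
  qed
  also have "\<dots> = val Q i (T y) + (\<Sum>j<K (T y). wt Q i (T y) j) * ((1 + b) * e)"
    by (simp add: val_def distrib_left sum.distrib sum_distrib_right)
  also have "\<dots> = val Q i (T y) + (1 + b) * e"
    using w by (simp add: weights_def)
  finally show ?thesis using split(1) by simp
qed

text \<open>Both costs are compared with the same function \<open>?V\<close>, the equilibrium cost
  from above and the cost of the deviation from below; hence the factor 2.\<close>

lemma stationary_equilibrium:
  assumes Q: "\<And>k. \<bar>Q k\<bar> \<le> b" "update Q = Q"
  defines "\<phi> \<equiv> \<lambda>i x. mixed Q (T x) i"
  shows "\<phi> i \<in> stationary_strategies X A i"
    and "x \<in> space X \<Longrightarrow> \<sigma> \<in> strategies X A i \<Longrightarrow>
      discounted_cost X A p \<alpha> (c i) (\<lambda>j. stationary (\<phi> j)) x - 2 * ((3 + 2 * b) * e) / (1 - \<alpha>)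
        \<le> discounted_cost X A p \<alpha> (c i) ((\<lambda>j. stationary (\<phi> j))(i := \<sigma>)) x"
proof -
  let ?\<eta> = "(3 + 2 * b) * e" and ?V = "\<lambda>y. val Q i (T y)"
  have \<phi>: "\<phi> l \<in> stationary_strategies X A l" for l
    unfolding stationary_strategies_def \<phi>_def
    by (rule measurable_compose[OF measurable_type])
      (simp add: space_prob_algebra prob_space_mixed sets_mixed)
  then show "\<phi> i \<in> stationary_strategies X A i" .
  have st: "stationary (\<phi> l) \<in> strategies X A l" for l
    using measurable_compose[OF measurable_snd \<phi>[of l, unfolded stationary_strategies_def]]
    by (auto simp: strategies_def stationary_def histories_def case_prod_beta')
  assume x: "x \<in> space X" and \<sigma>: "\<sigma> \<in> strategies X A i"
  interpret own: controlled_process X A p "\<lambda>j. stationary (\<phi> j)" x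
    by standard (use transition st x in auto)
  interpret dev: controlled_process X A p "(\<lambda>j. stationary (\<phi> j))(i := \<sigma>)" x
    by standard (use transition st \<sigma> x in auto)
  have c: "\<bar>c i z\<bar> \<le> b" if "z \<in> space (state_actions X A)" for z
    using that cost_bounded by (auto simp: space_state_actions)
  have upper: "discounted_cost X A p \<alpha> (c i) (\<lambda>j. stationary (\<phi> j)) x \<le> ?V x + ?\<eta> / (1 - \<alpha>)"
  proof (rule own.discounted_cost_upper_bound[OF discount cost_measurable c measurable_value val_bounded[OF Q(1)]])
    fix t \<omega> y assume y: "y \<in> space X"
    \<comment> \<open>The smaller error of the own play is enlarged, so that both bounds have the
      same constant.\<close>
    have "(1 + b) * e \<le> ?\<eta>" using b_pos e_pos by (intro mult_right_mono) auto
    with equilibrium_cost_le[OF Q y, of i]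
    have "(\<integral>a. utility i ?V y a \<partial>PiM UNIV (mixed Q (T y))) \<le> ?V y + ?\<eta>" by linarith
    then show "(\<integral>a. (1 - \<alpha>) * c i (y, a) + \<alpha> * (\<integral>z. ?V z \<partial>p (y, a)) \<partial>PiM UNIV (\<lambda>l. stationary (\<phi> l) t (\<omega>, y))) \<le> ?V y + ?\<eta>"
      by (simp add: stationary_def \<phi>_def utility_def)
  qed
  have lower: "?V x - ?\<eta> / (1 - \<alpha>) \<le> discounted_cost X A p \<alpha> (c i) ((\<lambda>j. stationary (\<phi> j))(i := \<sigma>)) x"
  proof (rule dev.discounted_cost_lower_bound[OF discount cost_measurable c measurable_value val_bounded[OF Q(1)]])
    \<comment> \<open>For a fixed past and state, \<open>\<sigma>\<close> prescribes some
      probability measure on \<open>A i\<close>. The bound for each pure action is averaged over it,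
      which covers history-dependent deviations although the equilibrium is stationary.\<close>
    fix t \<omega> y assume \<omega>: "\<omega> \<in> space (dev.H t)" and y: "y \<in> space X"
    have "\<sigma> t \<in> dev.H t \<Otimes>\<^sub>M X \<rightarrow>\<^sub>M prob_algebra (action_space A i)"
      using \<sigma> by (simp add: strategies_def histories_def)
    note \<sigma>t = kernelD[OF this, of "(\<omega>, y)"]
    have h: "(\<omega>, y) \<in> space (dev.H t \<Otimes>\<^sub>M X)" using \<omega> y by (simp add: space_pair_measure)
    interpret s: prob_space "\<sigma> t (\<omega>, y)" by (rule \<sigma>t(1)[OF h])
    note split = joint_cost_split[where s = "T y" and Q = Q, OF Q(1) y \<sigma>t(1,2)[OF h]]
    have "space (\<sigma> t (\<omega>, y)) = A i"
      using \<sigma>t(3)[OF h] by (simp add: action_space_def space_restrict_space)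
    then have "?V y - ?\<eta> \<le> (\<integral>a'. \<integral>a. utility i ?V y (a(i := a')) \<partial>PiM (- {i}) (mixed Q (T y)) \<partial>\<sigma> t (\<omega>, y))"
      by (intro s.integral_ge_const split(2) AE_I2 deviation_cost_ge Q y) simp
    also have "\<dots> = (\<integral>a. utility i ?V y a \<partial>PiM UNIV ((mixed Q (T y))(i := \<sigma> t (\<omega>, y))))"
      by (rule split(1)[symmetric])
    also have "(mixed Q (T y))(i := \<sigma> t (\<omega>, y)) = (\<lambda>l. ((\<lambda>j. stationary (\<phi> j))(i := \<sigma>)) l t (\<omega>, y))"
      by (auto simp: stationary_def \<phi>_def)
    finally show "?V y - ?\<eta> \<le> (\<integral>a. (1 - \<alpha>) * c i (y, a) + \<alpha> * (\<integral>z. ?V z \<partial>p (y, a))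
        \<partial>PiM UNIV (\<lambda>l. ((\<lambda>j. stationary (\<phi> j))(i := \<sigma>)) l t (\<omega>, y)))"
      unfolding utility_def .
  qed
  have "2 * ?\<eta> / (1 - \<alpha>) = ?\<eta> / (1 - \<alpha>) + ?\<eta> / (1 - \<alpha>)"
    by (simp flip: add_divide_distrib)
  with upper lower show "discounted_cost X A p \<alpha> (c i) (\<lambda>j. stationary (\<phi> j)) x - 2 * ?\<eta> / (1 - \<alpha>)
        \<le> discounted_cost X A p \<alpha> (c i) ((\<lambda>j. stationary (\<phi> j))(i := \<sigma>)) x"
    by linarith
qed

end

theorem theorem2p8:
  fixes X :: "'x measure"
    and A :: "'i::finite \<Rightarrow> 'a::metric_space set"
    and p :: "'x \<times> ('i \<Rightarrow> 'a) \<Rightarrow> 'x measure"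
    and c :: "'i \<Rightarrow> nat \<Rightarrow> 'x \<times> ('i \<Rightarrow> 'a) \<Rightarrow> real"
    and L :: nat
    and b \<alpha> \<epsilon> :: real
    and \<mu> :: "'x measure"
    and \<delta> :: "'x \<Rightarrow> 'x \<Rightarrow> ('i \<Rightarrow> 'a) \<Rightarrow> real"
  assumes state_space: "countably_generated X"
    and action_spaces: "\<And>i. compact (A i)" "\<And>i. A i \<noteq> {}"
    and cost_measurable: "\<And>i l. l \<le> L \<Longrightarrow> c i l \<in> borel_measurable (state_actions X A)"
    and cost_bounded: "b > 0"
      "\<And>i l x a. l \<le> L \<Longrightarrow> x \<in> space X \<Longrightarrow> a \<in> (\<Pi>\<^sub>E i\<in>UNIV. A i) \<Longrightarrow> \<bar>c i l (x, a)\<bar> \<le> b"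
    and transition: "p \<in> state_actions X A \<rightarrow>\<^sub>M prob_algebra X"
    and discount: "0 < \<alpha>" "\<alpha> < 1"
    and A1: "\<And>i l x. l \<le> L \<Longrightarrow> x \<in> space X \<Longrightarrow>
      continuous_on (\<Pi>\<^sub>E i\<in>UNIV. A i) (\<lambda>a. c i l (x, a))"
    and A2_reference: "prob_space \<mu>" "sets \<mu> = sets X"
    and A2_measurable: "(\<lambda>(x, y, a). \<delta> x y a) \<in> borel_measurable (X \<Otimes>\<^sub>M X \<Otimes>\<^sub>M joint_actions A)"
    and A2_nonneg: "\<And>x y a. x \<in> space X \<Longrightarrow> y \<in> space X \<Longrightarrow> a \<in> (\<Pi>\<^sub>E i\<in>UNIV. A i) \<Longrightarrow> \<delta> x y a \<ge> 0"
    and A2_density: "\<And>x a B. x \<in> space X \<Longrightarrow> a \<in> (\<Pi>\<^sub>E i\<in>UNIV. A i) \<Longrightarrow> B \<in> sets X \<Longrightarrow>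
      emeasure (p (x, a)) B = (\<integral>\<^sup>+y\<in>B. ennreal (\<delta> x y a) \<partial>\<mu>)"
    and A2_continuous: "\<And>x s a. x \<in> space X \<Longrightarrow> (\<And>n::nat. s n \<in> (\<Pi>\<^sub>E i\<in>UNIV. A i)) \<Longrightarrow>
      a \<in> (\<Pi>\<^sub>E i\<in>UNIV. A i) \<Longrightarrow> s \<longlonglongrightarrow> a \<Longrightarrow>
      (\<lambda>n. \<integral>y. \<bar>\<delta> x y (s n) - \<delta> x y a\<bar> \<partial>\<mu>) \<longlonglongrightarrow> 0"
    and epsilon: "\<epsilon> > 0"
  shows "\<exists>\<phi>. (\<forall>i. \<phi> i \<in> stationary_strategies X A i) \<and>
    (\<forall>i. \<forall>x\<in>space X.
      discounted_cost X A p \<alpha> (c i 0) (\<lambda>j. stationary (\<phi> j)) x - \<epsilon>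
        \<le> (INF \<sigma>\<in>strategies X A i.
             discounted_cost X A p \<alpha> (c i 0) ((\<lambda>j. stationary (\<phi> j))(i := \<sigma>)) x))"
proof -
  interpret game: stochastic_game X A p "\<lambda>i. c i 0" b \<alpha> \<mu> \<delta>
  proof (rule stochastic_game.intro)
    show "\<bar>c i 0 (x, a)\<bar> \<le> b" if "x \<in> space X" "a \<in> (\<Pi>\<^sub>E i\<in>UNIV. A i)" for i x a
      by (rule cost_bounded(2)[OF _ that]) simp
    show "continuous_on (\<Pi>\<^sub>E i\<in>UNIV. A i) (\<lambda>a. c i 0 (x, a))" if "x \<in> space X" for i x
      by (rule A1[OF _ that]) simp
    show "c i 0 \<in> borel_measurable (state_actions X A)" for i
      by (rule cost_measurable) simp
  qed (fact state_space action_spaces cost_bounded(1) transition discount A2_reference A2_measurable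
      A2_nonneg A2_density A2_continuous)+
  \<comment> \<open>Chosen so that the loss in \<open>stationary_equilibrium\<close> is exactly
    \<open>\<epsilon>\<close>.\<close>
  define e where "e = \<epsilon> * (1 - \<alpha>) / (2 * (3 + 2 * b))"
  have e: "e > 0" "2 * ((3 + 2 * b) * e) / (1 - \<alpha>) = \<epsilon>"
    using epsilon discount cost_bounded(1) by (simp_all add: e_def divide_simps)
  obtain d T K r where "discretized_game X A p (\<lambda>i. c i 0) b \<alpha> \<mu> \<delta> d T K r e"
  proof (rule game.discretization[OF e(1)])
    fix d :: "'i \<Rightarrow> nat \<Rightarrow> 'a" and T :: "'x \<Rightarrow> nat" and K :: "nat \<Rightarrow> nat" and r :: "nat \<Rightarrow> 'x"
    assume *: "\<And>i j. d i j \<in> A i" "T \<in> X \<rightarrow>\<^sub>M count_space UNIV" "\<And>s. r s \<in> space X"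
      "\<And>x f. x \<in> space X \<Longrightarrow> (\<And>i. f i < K (T x)) \<Longrightarrow>
        game.gap x (\<lambda>i. d i (f i)) (r (T x)) (\<lambda>i. d i (f i)) \<le> e"
      "\<And>x i a. x \<in> space X \<Longrightarrow> a \<in> A i \<Longrightarrow> \<exists>j<K (T x). \<forall>f.
        game.gap x ((\<lambda>i. d i (f i))(i := a)) x ((\<lambda>i. d i (f i))(i := d i j)) \<le> e"
      "\<And>s. K s > 0"
    have "discretized_game X A p (\<lambda>i. c i 0) b \<alpha> \<mu> \<delta> d T K r e"
      by (rule discretized_game.intro[OF game.stochastic_game_axioms], rule discretized_game_axioms.intro)
        (fact * e(1))+
    then show thesis by (rule that)
  qed
  then interpret fine: discretized_game X A p "\<lambda>i. c i 0" b \<alpha> \<mu> \<delta> d T K r e .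
  obtain Q :: "'i \<times> nat \<times> nat \<Rightarrow> real" where Q: "\<And>k. \<bar>Q k\<bar> \<le> b" "fine.update Q = Q"
    using fine.fixed_point by blast
  define \<phi> where "\<phi> i x = fine.mixed Q (T x) i" for i x
  have \<phi>: "\<phi> i \<in> stationary_strategies X A i" for i
    using fine.stationary_equilibrium(1)[OF Q] by (simp add: \<phi>_def[abs_def])
  have ge: "discounted_cost X A p \<alpha> (c i 0) (\<lambda>j. stationary (\<phi> j)) x - \<epsilon>
      \<le> discounted_cost X A p \<alpha> (c i 0) ((\<lambda>j. stationary (\<phi> j))(i := \<sigma>)) x"
    if "x \<in> space X" "\<sigma> \<in> strategies X A i" for i x \<sigma>
    using fine.stationary_equilibrium(2)[OF Q that] unfolding e(2) by (simp add: \<phi>_def[abs_def])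
  \<comment> \<open>A lower bound passes to a real infimum only over a nonempty family; the
    equilibrium strategy itself is a member.\<close>
  have "strategies X A i \<noteq> {}" for i
  proof -
    have "stationary (\<phi> i) \<in> strategies X A i"
      using measurable_compose[OF measurable_snd \<phi>[of i, unfolded stationary_strategies_def]]
      by (auto simp: strategies_def stationary_def histories_def case_prod_beta')
    then show ?thesis by blast
  qed
  with \<phi> ge show ?thesis
    by (intro exI[of _ \<phi>] conjI allI ballI cINF_greatest) auto
qed

end
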